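(* Let $K$ be a field of characteristic $0$, $X=\{x_1,x_2,\dots\}$ a finite or countable set of variables, and $M=M(X)$. The following formulas hold. (i) For $t$ a tree, $\Delta(t)=\sum_{I\subset I(t)}(t\vert I)\otimes(t\vert I^c)$; and $\Delta_s(t)$ is given by a sum $\sum_{s'}\mu_{s'}(t)\,s'$ over trees $s'$ which are complements of $s$ in $t$. (ii) $\Delta_{x_i}=D_i$. (iii) $\Delta_s\circ\Delta_t=\Delta_t\circ\Delta_s$ for all $s,t\in M$. (iv) $\Delta_s(fg)=\Delta_s(f)g+f\Delta_s(g)+\Delta_{s_1}(f)\Delta_{s_2}(g)$ for $s=s_1s_2$ of degree $>1$. Furthermore, $\mu_s(t)=\mu_s(t_1)+\mu_s(t_2)+\mu_{s_1}(t_1)\mu_{s_2}(t_2)$ for $t=t_1t_2$ a tree in $M$. (v) Let $M_n(\{x_i\})$ be the set of elements of degree $n$ in $M(\{x_i\})$. Then $\sum_{s\in M_n(\{x_i\})}\Delta_s=\frac{1}{n!}D_i^n$.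
   Context: $M(X)$ is the free magma (without unit) on $X$: planar binary rooted trees with leaves labeled by $X$; $M(\{x_i\})$ is the free magma on the single variable $x_i$; $\deg$ is the number of leaves. $1$ denotes the empty tree. $K\{X\}$ is the free unital, not necessarily associative, algebra on $X$, with basis $M(X)\cup\{1\}$, and $K\{\{X\}\}$ is its completion with respect to the total degree. The co-addition $\Delta$ is the algebra homomorphism defined on $K\{X\}$ (or $K\{\{X\}\}$) by $\Delta(x_i)=x_i\otimes 1+1\otimes x_i$. $D_i$ is the unique $K$-linear derivation on $K\{\{X\}\}$ with $D_i(x_i)=1$ and $D_i(x_j)=0$ for $j\neq i$. For a tree monomial $s$ and $f\in K\{\{X\}\}$, $\Delta_s(f)$ is defined by $\Delta(f)=\sum_s\Delta_s(f)\otimes s$ (the sum including the empty tree $s=1$). In (iv), $f,g\in K\{\{X\}\}$. For a tree $t$, $I(t)$ is the set of leaves of $t$, with $I(t)=I(t_1)\uplus I(t_2)$ if $t=t_1t_2$. For $I\subset I(t)$, the contraction $t\vert I$ is the tree with set of leaves $I$ defined recursively by $t_1t_2\vert I=(t_1\vert I\cap I(t_1))\cdot(t_2\vert I\cap I(t_2))$, with $t\vert\emptyset=1$ ($1$ being neutral for the multiplication), and $t\vert I(t)=t$. $I^c$ is the complement of $I$ in $I(t)$. $\mu_s(t)$ is the number of subsets $I$ of $I(t)$ with $t\vert I=s$. If $t\vert I=s$, the tree $s'=t\vert I^c$ is called a complement of $s$ in $t$.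
   Formalization: In (i) the coefficient μ_{s'}(t) is replaced by the number of I with t|I=s', t|I^c=s, since the printed formula fails for t=(xx)((xx)x), s=(xx)(xx); the printed one is proved when s is the only complement of each s'. In (v), n≥1. Δ and D_i are taken continuous. *)

theory Defs
  imports Complex_Main "HOL-Library.Countable"
begin

section \<open>Trees\<close>

text \<open>\<open>'x mtree\<close> is the free magma \<open>M(X)\<close> on the set \<open>X\<close> of all elements of type \<open>'x\<close>;
  \<open>'x utree\<close> is \<open>M(X) \<union> {1}\<close>, with \<open>Emp\<close> the empty tree \<open>1\<close>.\<close>

datatype 'x mtree = MLeaf 'x | MNode "'x mtree" "'x mtree"

datatype 'x utree = Emp | Tr "'x mtree"

primrec nleaves :: "'x mtree \<Rightarrow> nat" where
  "nleaves (MLeaf x) = 1"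
| "nleaves (MNode s t) = nleaves s + nleaves t"

text \<open>A magma with unit and an additive degree. The instances are \<open>M(X) \<union> {1}\<close> and its square,
  which is the multiplicative basis of \<open>K{X} \<otimes> K{X}\<close>.\<close>

class graded_umagma = times + one +
  fixes mdeg :: "'a \<Rightarrow> nat"
  assumes umagma_one_left [simp]: "1 * a = a"
    and umagma_one_right [simp]: "a * 1 = a"
    and mdeg_mult [simp]: "mdeg (a * b) = mdeg a + mdeg b"

lemma mdeg_one [simp]: "mdeg (1 :: 'a :: graded_umagma) = 0"
  using mdeg_mult[of "1 :: 'a" 1] by simp

instantiation utree :: (type) graded_umagma
begin

definition one_utree :: "'a utree" where
  "one_utree = Emp"

fun times_utree :: "'a utree \<Rightarrow> 'a utree \<Rightarrow> 'a utree" where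
  "times_utree Emp b = b"
| "times_utree (Tr s) Emp = Tr s"
| "times_utree (Tr s) (Tr t) = Tr (MNode s t)"

fun mdeg_utree :: "'a utree \<Rightarrow> nat" where
  "mdeg_utree Emp = 0"
| "mdeg_utree (Tr t) = nleaves t"

instance
proof
  fix a b :: "'a utree"
  show "1 * a = a" by (simp add: one_utree_def)
  show "a * 1 = a" by (cases a) (simp_all add: one_utree_def)
  show "mdeg (a * b) = mdeg a + mdeg b" by (cases a; cases b) simp_all
qed

end

instantiation prod :: (graded_umagma, graded_umagma) graded_umagma
begin

definition one_prod :: "'a \<times> 'b" where
  "one_prod = (1, 1)"

definition times_prod :: "'a \<times> 'b \<Rightarrow> 'a \<times> 'b \<Rightarrow> 'a \<times> 'b" where
  "times_prod p q = (fst p * fst q, snd p * snd q)"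

definition mdeg_prod :: "'a \<times> 'b \<Rightarrow> nat" where
  "mdeg_prod p = mdeg (fst p) + mdeg (snd p)"

instance
  by standard (simp_all add: one_prod_def times_prod_def mdeg_prod_def)

end

section \<open>Completed algebras\<close>

text \<open>The completion, with respect to the degree, of the algebra with basis \<open>'m\<close> over \<open>'k\<close>: formal
  sums having only finitely many terms in each degree (there may be infinitely many basis
  elements of a given degree). Thus \<open>K{{X}}\<close> is \<open>('x, 'k) tree_series\<close>, and
  \<open>('x, 'k) tensor_series\<close> is the completion of \<open>K{X} \<otimes> K{X}\<close> with respect to the total
  degree, the pair \<open>(a, b)\<close> standing for \<open>a \<otimes> b\<close>.\<close>

typedef (overloaded) ('m, 'k) mseries =
  "{f :: 'm :: graded_umagma \<Rightarrow> 'k :: field. \<forall>n. finite {m. mdeg m = n \<and> f m \<noteq> 0}}"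
  morphisms coeff Abs_mseries
  by (rule exI[of _ "\<lambda>_. 0"]) simp

type_synonym ('x, 'k) tree_series = "('x utree, 'k) mseries"
type_synonym ('x, 'k) tensor_series = "('x utree \<times> 'x utree, 'k) mseries"

lemma finite_coeff: "finite {m. mdeg m = n \<and> coeff f m \<noteq> 0}"
  using coeff[of f] by simp

lemma finite_coeff_le: "finite {m. mdeg m \<le> n \<and> coeff f m \<noteq> 0}"
proof -
  have "{m. mdeg m \<le> n \<and> coeff f m \<noteq> 0} = (\<Union>k\<le>n. {m. mdeg m = k \<and> coeff f m \<noteq> 0})" by auto
  then show ?thesis by (simp add: finite_coeff)
qed

lemma mseries_eqI: "(\<And>m. coeff f m = coeff g m) \<Longrightarrow> f = g"
  by (metis coeff_inject ext)

lemma coeff_Abs: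
  assumes "\<And>n. finite {m. mdeg m = n \<and> f m \<noteq> 0}"
  shows "coeff (Abs_mseries f) = f"
  using assms by (intro Abs_mseries_inverse) simp

definition monom :: "'m :: graded_umagma \<Rightarrow> ('m, 'k :: field) mseries" where
  "monom m = Abs_mseries (\<lambda>m'. if m' = m then 1 else 0)"

definition scale :: "'k \<Rightarrow> ('m :: graded_umagma, 'k :: field) mseries \<Rightarrow> ('m, 'k) mseries" where
  "scale c f = Abs_mseries (\<lambda>m. c * coeff f m)"

instantiation mseries :: (graded_umagma, field) "{ab_group_add, times, one}"
begin

definition zero_mseries :: "('a, 'b) mseries" where
  "zero_mseries = Abs_mseries (\<lambda>_. 0)"

definition plus_mseries :: "('a, 'b) mseries \<Rightarrow> ('a, 'b) mseries \<Rightarrow> ('a, 'b) mseries" where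
  "plus_mseries f g = Abs_mseries (\<lambda>m. coeff f m + coeff g m)"

definition uminus_mseries :: "('a, 'b) mseries \<Rightarrow> ('a, 'b) mseries" where
  "uminus_mseries f = Abs_mseries (\<lambda>m. - coeff f m)"

definition minus_mseries :: "('a, 'b) mseries \<Rightarrow> ('a, 'b) mseries \<Rightarrow> ('a, 'b) mseries" where
  "minus_mseries f g = Abs_mseries (\<lambda>m. coeff f m - coeff g m)"

definition one_mseries :: "('a, 'b) mseries" where
  "one_mseries = monom 1"

definition times_mseries :: "('a, 'b) mseries \<Rightarrow> ('a, 'b) mseries \<Rightarrow> ('a, 'b) mseries" where
  "times_mseries f g = Abs_mseries (\<lambda>m.
     \<Sum>(a, b) \<in> {(a, b). a * b = m \<and> coeff f a \<noteq> 0 \<and> coeff g b \<noteq> 0}. coeff f a * coeff g b)"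

lemma coeff_zero' [simp]: "coeff 0 m = 0"
  by (simp add: zero_mseries_def coeff_Abs)

lemma coeff_plus' [simp]: "coeff (f + g) m = coeff f m + coeff g m"
proof -
  have "finite {m. mdeg m = n \<and> coeff f m + coeff g m \<noteq> 0}" for n
    by (rule finite_subset[OF _ finite_UnI[OF finite_coeff[of n f] finite_coeff[of n g]]]) auto
  from coeff_Abs[OF this] show ?thesis unfolding plus_mseries_def by simp
qed

lemma coeff_uminus' [simp]: "coeff (- f) m = - coeff f m"
proof -
  have "finite {m. mdeg m = n \<and> - coeff f m \<noteq> 0}" for n
    using finite_coeff[of n f] by simp
  from coeff_Abs[OF this] show ?thesis unfolding uminus_mseries_def by simp
qed

lemma coeff_minus' [simp]: "coeff (f - g) m = coeff f m - coeff g m"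
proof -
  have "finite {m. mdeg m = n \<and> coeff f m - coeff g m \<noteq> 0}" for n
    by (rule finite_subset[OF _ finite_UnI[OF finite_coeff[of n f] finite_coeff[of n g]]]) auto
  from coeff_Abs[OF this] show ?thesis unfolding minus_mseries_def by simp
qed

instance
  by standard (auto intro!: mseries_eqI)

end

lemma coeff_sum: "coeff (sum F A) m = (\<Sum>i\<in>A. coeff (F i) m)"
  by (induction A rule: infinite_finite_induct) auto

lemma coeff_monom: "coeff (monom m :: ('m :: graded_umagma, 'k :: field) mseries) m' = (if m' = m then 1 else 0)"
proof -
  have "finite {m'. mdeg m' = n \<and> (if m' = m then 1 else 0 :: 'k) \<noteq> 0}" for n
    by (rule finite_subset[of _ "{m}"]) auto
  from coeff_Abs[OF this] show ?thesis unfolding monom_def by simp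
qed

lemma coeff_scale [simp]: "coeff (scale c f) m = c * coeff f m"
proof -
  have "finite {m. mdeg m = n \<and> c * coeff f m \<noteq> 0}" for n
    by (rule finite_subset[OF _ finite_coeff[of n f]]) auto
  from coeff_Abs[OF this] show ?thesis unfolding scale_def by simp
qed

text \<open>The product is the usual convolution.\<close>

lemma finite_factor_pairs:
  "finite {(a, b). a * b = m \<and> coeff f a \<noteq> 0 \<and> coeff g b \<noteq> 0}"
proof (rule finite_subset)
  show "{(a, b). a * b = m \<and> coeff f a \<noteq> 0 \<and> coeff g b \<noteq> 0} \<subseteq>
    {a. mdeg a \<le> mdeg m \<and> coeff f a \<noteq> 0} \<times> {b. mdeg b \<le> mdeg m \<and> coeff g b \<noteq> 0}" by auto
qed (intro finite_cartesian_product finite_coeff_le)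

lemma coeff_times:
  "coeff (f * g) m =
    (\<Sum>(a, b) \<in> {(a, b). a * b = m \<and> coeff f a \<noteq> 0 \<and> coeff g b \<noteq> 0}. coeff f a * coeff g b)"
proof -
  let ?h = "\<lambda>m. \<Sum>(a, b) \<in> {(a, b). a * b = m \<and> coeff f a \<noteq> 0 \<and> coeff g b \<noteq> 0}. coeff f a * coeff g b"
  have "finite {m. mdeg m = n \<and> ?h m \<noteq> 0}" for n
  proof (rule finite_subset)
    show "{m. mdeg m = n \<and> ?h m \<noteq> 0} \<subseteq> (\<lambda>(a, b). a * b) `
      ({a. mdeg a \<le> n \<and> coeff f a \<noteq> 0} \<times> {b. mdeg b \<le> n \<and> coeff g b \<noteq> 0})"
    proof
      fix m assume "m \<in> {m. mdeg m = n \<and> ?h m \<noteq> 0}"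
      then obtain a b where "a * b = m" "coeff f a \<noteq> 0" "coeff g b \<noteq> 0" "mdeg m = n"
        by (auto elim!: sum.not_neutral_contains_not_neutral)
      then show "m \<in> (\<lambda>(a, b). a * b) `
        ({a. mdeg a \<le> n \<and> coeff f a \<noteq> 0} \<times> {b. mdeg b \<le> n \<and> coeff g b \<noteq> 0})"
        by (intro image_eqI[of _ _ "(a, b)"]) auto
    qed
  qed (intro finite_imageI finite_cartesian_product finite_coeff_le)
  from coeff_Abs[OF this] show ?thesis unfolding times_mseries_def by simp
qed

lemma coeff_times_superset:
  assumes "finite S" "{(a, b). a * b = m \<and> coeff f a \<noteq> 0 \<and> coeff g b \<noteq> 0} \<subseteq> S"
    and "S \<subseteq> {(a, b). a * b = m}"
  shows "coeff (f * g) m = (\<Sum>(a, b) \<in> S. coeff f a * coeff g b)"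
  unfolding coeff_times by (rule sum.mono_neutral_left) (use assms in auto)

definition tensor ::
  "('m :: graded_umagma, 'k :: field) mseries \<Rightarrow> ('n :: graded_umagma, 'k) mseries \<Rightarrow> ('m \<times> 'n, 'k) mseries"
  where "tensor f g = Abs_mseries (\<lambda>(a, b). coeff f a * coeff g b)"

lemma coeff_tensor [simp]: "coeff (tensor f g) (a, b) = coeff f a * coeff g b"
proof -
  have "finite {p. mdeg p = n \<and> (case p of (a, b) \<Rightarrow> coeff f a * coeff g b) \<noteq> 0}" for n
  proof (rule finite_subset)
    show "{p. mdeg p = n \<and> (case p of (a, b) \<Rightarrow> coeff f a * coeff g b) \<noteq> 0} \<subseteq>
      {a. mdeg a \<le> n \<and> coeff f a \<noteq> 0} \<times> {b. mdeg b \<le> n \<and> coeff g b \<noteq> 0}"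
      by (auto simp: mdeg_prod_def)
  qed (intro finite_cartesian_product finite_coeff_le)
  from coeff_Abs[OF this] show ?thesis unfolding tensor_def by simp
qed

section \<open>Continuous homomorphisms and derivations\<close>

definition klinear ::
  "(('m :: graded_umagma, 'k :: field) mseries \<Rightarrow> ('n :: graded_umagma, 'k) mseries) \<Rightarrow> bool" where
  "klinear \<phi> \<longleftrightarrow> (\<forall>f g. \<phi> (f + g) = \<phi> f + \<phi> g) \<and> (\<forall>c f. \<phi> (scale c f) = scale c (\<phi> f))"

text \<open>Continuity (at 0) for the topologies defined by the degree filtrations.\<close>

definition kcontinuous ::
  "(('m :: graded_umagma, 'k :: field) mseries \<Rightarrow> ('n :: graded_umagma, 'k) mseries) \<Rightarrow> bool" where
  "kcontinuous \<phi> \<longleftrightarrow> (\<forall>n. \<exists>N. \<forall>f. (\<forall>m. mdeg m < N \<longrightarrow> coeff f m = 0) \<longrightarrow>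
     (\<forall>m. mdeg m < n \<longrightarrow> coeff (\<phi> f) m = 0))"

definition alg_hom ::
  "(('m :: graded_umagma, 'k :: field) mseries \<Rightarrow> ('n :: graded_umagma, 'k) mseries) \<Rightarrow> bool" where
  "alg_hom \<phi> \<longleftrightarrow> klinear \<phi> \<and> \<phi> 1 = 1 \<and> (\<forall>f g. \<phi> (f * g) = \<phi> f * \<phi> g)"

definition derivation ::
  "(('m :: graded_umagma, 'k :: field) mseries \<Rightarrow> ('m, 'k) mseries) \<Rightarrow> bool" where
  "derivation \<delta> \<longleftrightarrow> klinear \<delta> \<and> (\<forall>f g. \<delta> (f * g) = \<delta> f * g + f * \<delta> g)"

definition var :: "'x \<Rightarrow> ('x, 'k :: field) tree_series" where
  "var i = monom (Tr (MLeaf i))"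

definition is_coaddition :: "(('x, 'k :: field) tree_series \<Rightarrow> ('x, 'k) tensor_series) \<Rightarrow> bool" where
  "is_coaddition \<phi> \<longleftrightarrow> alg_hom \<phi> \<and> kcontinuous \<phi> \<and>
     (\<forall>i. \<phi> (var i) = tensor (var i) 1 + tensor 1 (var i))"

text \<open>The co-addition \<open>\<Delta>\<close> and the derivations \<open>D\<^sub>i\<close>. Since polynomials are only dense in
  \<open>K{{X}}\<close>, being determined by the values on the variables refers to continuous maps;
  existence and uniqueness are proved below.\<close>

definition coadd :: "('x, 'k :: field) tree_series \<Rightarrow> ('x, 'k) tensor_series" where
  "coadd = (THE \<phi>. is_coaddition \<phi>)"

definition is_partial :: "'x \<Rightarrow> (('x, 'k :: field) tree_series \<Rightarrow> ('x, 'k) tree_series) \<Rightarrow> bool" where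
  "is_partial i \<delta> \<longleftrightarrow> derivation \<delta> \<and> kcontinuous \<delta> \<and>
     (\<forall>j. \<delta> (var j) = (if j = i then 1 else 0))"

definition partial :: "'x \<Rightarrow> ('x, 'k :: field) tree_series \<Rightarrow> ('x, 'k) tree_series" where
  "partial i = (THE \<delta>. is_partial i \<delta>)"

text \<open>The component \<open>\<Delta>\<^sub>s(f)\<close> in \<open>\<Delta>(f) = \<Sum>\<^sub>s \<Delta>\<^sub>s(f) \<otimes> s\<close>.\<close>

definition coadd_part :: "'x utree \<Rightarrow> ('x, 'k :: field) tree_series \<Rightarrow> ('x, 'k) tree_series" where
  "coadd_part s f = Abs_mseries (\<lambda>a. coeff (coadd f) (a, s))"

section \<open>Contractions\<close>

text \<open>Leaves are addressed by their paths from the root (\<open>False\<close> = left, \<open>True\<close> = right), so that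
  \<open>leaves t\<^sub>1\<close> and \<open>leaves t\<^sub>2\<close> correspond to the paths in \<open>t\<^sub>1t\<^sub>2\<close> starting with \<open>False\<close> and
  \<open>True\<close>, respectively.\<close>

primrec leaves :: "'x mtree \<Rightarrow> bool list set" where
  "leaves (MLeaf x) = {[]}"
| "leaves (MNode s t) = (#) False ` leaves s \<union> (#) True ` leaves t"

primrec contract :: "'x mtree \<Rightarrow> bool list set \<Rightarrow> 'x utree" where
  "contract (MLeaf x) I = (if [] \<in> I then Tr (MLeaf x) else 1)"
| "contract (MNode s t) I = contract s {p. False # p \<in> I} * contract t {p. True # p \<in> I}"

definition mult_in :: "'x utree \<Rightarrow> 'x mtree \<Rightarrow> nat" where
  "mult_in s t = card {I. I \<subseteq> leaves t \<and> contract t I = s}"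

definition complements :: "'x utree \<Rightarrow> 'x mtree \<Rightarrow> 'x utree set" where
  "complements s t = {contract t (leaves t - I) | I. I \<subseteq> leaves t \<and> contract t I = s}"

text \<open>The number of times \<open>s'\<close> occurs as a complement of \<open>s\<close> in \<open>t\<close>. It may be smaller than
  \<open>mult_in s' t\<close>: for \<open>t = (xx)((xx)x)\<close>, \<open>s = (xx)(xx)\<close> and \<open>s' = x\<close> it is 3, whereas
  \<open>mult_in s' t = 5\<close>.\<close>

definition compl_mult_in :: "'x utree \<Rightarrow> 'x utree \<Rightarrow> 'x mtree \<Rightarrow> nat" where
  "compl_mult_in s s' t =
     card {I. I \<subseteq> leaves t \<and> contract t I = s' \<and> contract t (leaves t - I) = s}"

definition one_var_trees :: "'x \<Rightarrow> nat \<Rightarrow> 'x mtree set" where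
  "one_var_trees i n = {s. set_mtree s \<subseteq> {i} \<and> nleaves s = n}"

section \<open>Existence and uniqueness\<close>

lemma card_leaves: "card (leaves t) = nleaves t" and finite_leaves [simp]: "finite (leaves t)"
proof (induction t)
  case (MNode s t)
  {
    case 1
    have "(#) False ` leaves s \<inter> (#) True ` leaves t = {}" by auto
    then show ?case using MNode by (simp add: card_Un_disjoint card_image)
  next
    case 2
    then show ?case using MNode by simp
  }
qed simp_all

lemma contract_empty: "contract t {} = 1"
  by (induction t) simp_all

lemma contract_leaves: "contract t (leaves t) = Tr t"
proof (induction t)
  case (MNode s t)
  have "{p. False # p \<in> leaves (MNode s t)} = leaves s" "{p. True # p \<in> leaves (MNode s t)} = leaves t"
    by auto
  with MNode show ?case by simp
qed simp

lemma coeff_coadd_part: "coeff (coadd_part s f) a = coeff (coadd f) (a, s)"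
proof -
  have "finite {a. mdeg a = n \<and> coeff (coadd f) (a, s) \<noteq> 0}" for n
  proof (rule finite_imageD)
    show "finite ((\<lambda>a. (a, s)) ` {a. mdeg a = n \<and> coeff (coadd f) (a, s) \<noteq> 0})"
      by (rule finite_subset[OF _ finite_coeff[of "n + mdeg s" "coadd f"]]) (auto simp: mdeg_prod_def)
  qed (auto simp: inj_on_def)
  from coeff_Abs[OF this] show ?thesis unfolding coadd_part_def by simp
qed

lemma coadd_expansion:
  assumes "finite S" "b \<in> S"
  shows "coeff (coadd f) (a, b) = coeff (\<Sum>s\<in>S. tensor (coadd_part s f) (monom s)) (a, b)"
proof -
  have "(\<Sum>s\<in>S. coeff (tensor (coadd_part s f) (monom s)) (a, b)) =
    (\<Sum>s\<in>S. if b = s then coeff (coadd f) (a, s) else 0)"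
    by (rule sum.cong) (simp_all add: coeff_monom coeff_coadd_part)
  also have "\<dots> = coeff (coadd f) (a, b)" using assms by simp
  finally show ?thesis by (simp add: coeff_sum)
qed

lemma klinear_add: "klinear \<phi> \<Longrightarrow> \<phi> (f + g) = \<phi> f + \<phi> g"
  and klinear_scale: "klinear \<phi> \<Longrightarrow> \<phi> (scale c f) = scale c (\<phi> f)"
  unfolding klinear_def by blast+

lemma klinear_zero:
  assumes "klinear \<phi>"
  shows "\<phi> 0 = 0"
proof -
  have "\<phi> 0 + 0 = \<phi> 0 + \<phi> 0" using klinear_add[OF assms, of 0 0] by (simp only: add_0_right)
  then show ?thesis by (simp only: add_left_cancel)
qed

lemma klinear_sum:
  assumes "klinear \<phi>"
  shows "\<phi> (sum F A) = (\<Sum>i\<in>A. \<phi> (F i))"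
  by (induction A rule: infinite_finite_induct) (simp_all add: klinear_zero[OF assms] klinear_add[OF assms])

lemma continuous_linear_eqI:
  fixes \<phi> \<psi> :: "('m :: graded_umagma, 'k :: field) mseries \<Rightarrow> ('n :: graded_umagma, 'k) mseries"
  assumes "klinear \<phi>" "kcontinuous \<phi>" "klinear \<psi>" "kcontinuous \<psi>"
    and eq: "\<And>m. \<phi> (monom m) = \<psi> (monom m)"
  shows "\<phi> = \<psi>"
proof (intro ext mseries_eqI)
  fix f :: "('m, 'k) mseries" and p :: 'n
  obtain N1 where N1: "\<forall>f. (\<forall>m. mdeg m < N1 \<longrightarrow> coeff f m = 0) \<longrightarrow>
      (\<forall>m. mdeg m < Suc (mdeg p) \<longrightarrow> coeff (\<phi> f) m = 0)"
    using assms(2) unfolding kcontinuous_def by blast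
  obtain N2 where N2: "\<forall>f. (\<forall>m. mdeg m < N2 \<longrightarrow> coeff f m = 0) \<longrightarrow>
      (\<forall>m. mdeg m < Suc (mdeg p) \<longrightarrow> coeff (\<psi> f) m = 0)"
    using assms(4) unfolding kcontinuous_def by blast
  define A where "A = {m. mdeg m \<le> max N1 N2 \<and> coeff f m \<noteq> 0}"
  have fin: "finite A" unfolding A_def by (rule finite_coeff_le)
  define g where "g = (\<Sum>m\<in>A. scale (coeff f m) (monom m))"
  define h where "h = f - g"
  have f: "f = g + h" by (simp add: h_def)
  have cg: "coeff g m = (if m \<in> A then coeff f m else 0)" for m
  proof -
    have "coeff g m = (\<Sum>m'\<in>A. if m = m' then coeff f m' else 0)"
      by (simp add: g_def coeff_sum coeff_monom cong: if_cong) (rule sum.cong; simp)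
    then show ?thesis using fin by simp
  qed
  have h0: "coeff h m = 0" if "mdeg m \<le> max N1 N2" for m
    using that by (simp add: h_def cg) (simp add: A_def)
  have "coeff (\<phi> h) p = 0" by (rule N1[rule_format]) (auto intro: h0)
  moreover have "coeff (\<psi> h) p = 0" by (rule N2[rule_format]) (auto intro: h0)
  moreover have "\<phi> g = \<psi> g"
    by (simp add: g_def klinear_sum[OF assms(1)] klinear_sum[OF assms(3)]
      klinear_scale[OF assms(1)] klinear_scale[OF assms(3)] eq)
  ultimately show "coeff (\<phi> f) p = coeff (\<psi> f) p"
    by (simp add: f klinear_add[OF assms(1)] klinear_add[OF assms(3)])
qed

lemma times_add_left: "(f + g) * h = f * h + g * (h :: ('m :: graded_umagma, 'k :: field) mseries)"
proof (rule mseries_eqI)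
  fix m
  let ?S = "{(a, b). a * b = m \<and> coeff f a \<noteq> 0 \<and> coeff h b \<noteq> 0} \<union>
    {(a, b). a * b = m \<and> coeff g a \<noteq> 0 \<and> coeff h b \<noteq> 0}"
  have fin: "finite ?S" by (intro finite_UnI finite_factor_pairs)
  have "coeff ((f + g) * h) m = (\<Sum>(a, b)\<in>?S. coeff (f + g) a * coeff h b)"
    by (rule coeff_times_superset[OF fin]) auto
  moreover have "coeff (f * h) m = (\<Sum>(a, b)\<in>?S. coeff f a * coeff h b)"
    by (rule coeff_times_superset[OF fin]) auto
  moreover have "coeff (g * h) m = (\<Sum>(a, b)\<in>?S. coeff g a * coeff h b)"
    by (rule coeff_times_superset[OF fin]) auto
  ultimately show "coeff ((f + g) * h) m = coeff (f * h + g * h) m"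
    unfolding coeff_plus' by (simp only: case_prod_unfold distrib_right sum.distrib)
qed

lemma times_add_right: "h * (f + g) = h * f + h * (g :: ('m :: graded_umagma, 'k :: field) mseries)"
proof (rule mseries_eqI)
  fix m
  let ?S = "{(a, b). a * b = m \<and> coeff h a \<noteq> 0 \<and> coeff f b \<noteq> 0} \<union>
    {(a, b). a * b = m \<and> coeff h a \<noteq> 0 \<and> coeff g b \<noteq> 0}"
  have fin: "finite ?S" by (intro finite_UnI finite_factor_pairs)
  have "coeff (h * (f + g)) m = (\<Sum>(a, b)\<in>?S. coeff h a * coeff (f + g) b)"
    by (rule coeff_times_superset[OF fin]) auto
  moreover have "coeff (h * f) m = (\<Sum>(a, b)\<in>?S. coeff h a * coeff f b)"
    by (rule coeff_times_superset[OF fin]) auto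
  moreover have "coeff (h * g) m = (\<Sum>(a, b)\<in>?S. coeff h a * coeff g b)"
    by (rule coeff_times_superset[OF fin]) auto
  ultimately show "coeff (h * (f + g)) m = coeff (h * f + h * g) m"
    unfolding coeff_plus' by (simp only: case_prod_unfold distrib_left sum.distrib)
qed

lemma scale_times_left: "scale c f * g = scale c (f * g)"
proof (rule mseries_eqI)
  fix m
  have "coeff (scale c f * g) m =
    (\<Sum>(a, b)\<in>{(a, b). a * b = m \<and> coeff f a \<noteq> 0 \<and> coeff g b \<noteq> 0}. coeff (scale c f) a * coeff g b)"
    by (rule coeff_times_superset[OF finite_factor_pairs]) auto
  then show "coeff (scale c f * g) m = coeff (scale c (f * g)) m"
    by (simp add: coeff_times sum_distrib_left case_prod_unfold mult.assoc)
qed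

lemma scale_times_right: "f * scale c g = scale c (f * g)"
proof (rule mseries_eqI)
  fix m
  have "coeff (f * scale c g) m =
    (\<Sum>(a, b)\<in>{(a, b). a * b = m \<and> coeff f a \<noteq> 0 \<and> coeff g b \<noteq> 0}. coeff f a * coeff (scale c g) b)"
    by (rule coeff_times_superset[OF finite_factor_pairs]) auto
  then show "coeff (f * scale c g) m = coeff (scale c (f * g)) m"
    by (simp add: coeff_times sum_distrib_left case_prod_unfold mult_ac)
qed

lemma monom_mult: "monom a * monom b = monom (a * b)"
proof (rule mseries_eqI)
  fix m
  have "{(a', b'). a' * b' = m \<and> coeff (monom a :: ('a, 'b) mseries) a' \<noteq> 0 \<and>
      coeff (monom b :: ('a, 'b) mseries) b' \<noteq> 0} = (if a * b = m then {(a, b)} else {})"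
    by (auto simp: coeff_monom split: if_splits)
  then show "coeff (monom a * monom b :: ('a, 'b) mseries) m = coeff (monom (a * b)) m"
    by (simp add: coeff_times coeff_monom)
qed

lemma klinear_times_left: "klinear (\<lambda>f. f * g)"
  and klinear_times_right: "klinear (\<lambda>f. g * f)"
  by (simp_all add: klinear_def times_add_left times_add_right scale_times_left scale_times_right)

lemma kcontinuous_times_left:
  fixes g :: "('m :: graded_umagma, 'k :: field) mseries"
  shows "kcontinuous (\<lambda>f. f * g)"
  unfolding kcontinuous_def
proof (intro allI exI impI)
  fix n and m :: 'm and f :: "('m, 'k) mseries" assume f: "\<forall>m. mdeg m < n \<longrightarrow> coeff f m = 0" and m: "mdeg m < n"
  have "coeff f a = 0" if "a * b = m" for a b
    using f m that mdeg_mult[of a b] by simp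
  then have empty: "{(a, b). a * b = m \<and> coeff f a \<noteq> 0 \<and> coeff g b \<noteq> 0} = {}" by blast
  show "coeff (f * g) m = 0" unfolding coeff_times empty by simp
qed

lemma kcontinuous_times_right:
  fixes g :: "('m :: graded_umagma, 'k :: field) mseries"
  shows "kcontinuous (\<lambda>f. g * f)"
  unfolding kcontinuous_def
proof (intro allI exI impI)
  fix n and m :: 'm and f :: "('m, 'k) mseries" assume f: "\<forall>m. mdeg m < n \<longrightarrow> coeff f m = 0" and m: "mdeg m < n"
  have "coeff f b = 0" if "a * b = m" for a b
    using f m that mdeg_mult[of a b] by simp
  then have empty: "{(a, b). a * b = m \<and> coeff g a \<noteq> 0 \<and> coeff f b \<noteq> 0} = {}" by blast
  show "coeff (g * f) m = 0" unfolding coeff_times empty by simp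
qed

lemma klinear_comp: "klinear \<phi> \<Longrightarrow> klinear \<psi> \<Longrightarrow> klinear (\<lambda>f. \<phi> (\<psi> f))"
  by (simp add: klinear_def)

lemma kcontinuous_comp: "kcontinuous \<phi> \<Longrightarrow> kcontinuous \<psi> \<Longrightarrow> kcontinuous (\<lambda>f. \<phi> (\<psi> f))"
  unfolding kcontinuous_def
proof
  fix n
  assume \<phi>: "\<forall>n. \<exists>N. \<forall>f. (\<forall>m. mdeg m < N \<longrightarrow> coeff f m = 0) \<longrightarrow> (\<forall>m. mdeg m < n \<longrightarrow> coeff (\<phi> f) m = 0)"
    and \<psi>: "\<forall>n. \<exists>N. \<forall>f. (\<forall>m. mdeg m < N \<longrightarrow> coeff f m = 0) \<longrightarrow> (\<forall>m. mdeg m < n \<longrightarrow> coeff (\<psi> f) m = 0)"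
  obtain N where N: "\<forall>f. (\<forall>m. mdeg m < N \<longrightarrow> coeff f m = 0) \<longrightarrow> (\<forall>m. mdeg m < n \<longrightarrow> coeff (\<phi> f) m = 0)"
    using \<phi> by blast
  obtain N' where N': "\<forall>f. (\<forall>m. mdeg m < N' \<longrightarrow> coeff f m = 0) \<longrightarrow> (\<forall>m. mdeg m < N \<longrightarrow> coeff (\<psi> f) m = 0)"
    using \<psi> by blast
  show "\<exists>N. \<forall>f. (\<forall>m. mdeg m < N \<longrightarrow> coeff f m = 0) \<longrightarrow> (\<forall>m. mdeg m < n \<longrightarrow> coeff (\<phi> (\<psi> f)) m = 0)"
    using N N' by (intro exI[of _ N']) simp
qed

lemma klinear_plus: "klinear \<phi> \<Longrightarrow> klinear \<psi> \<Longrightarrow> klinear (\<lambda>f. \<phi> f + \<psi> f)"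
  by (auto simp: klinear_def intro!: mseries_eqI simp: distrib_left)

lemma kcontinuous_plus:
  assumes "kcontinuous \<phi>" "kcontinuous \<psi>" shows "kcontinuous (\<lambda>f. \<phi> f + \<psi> f)"
  unfolding kcontinuous_def
proof
  fix n
  obtain N1 where N1: "\<forall>f. (\<forall>m. mdeg m < N1 \<longrightarrow> coeff f m = 0) \<longrightarrow> (\<forall>m. mdeg m < n \<longrightarrow> coeff (\<phi> f) m = 0)"
    using assms(1) unfolding kcontinuous_def by blast
  obtain N2 where N2: "\<forall>f. (\<forall>m. mdeg m < N2 \<longrightarrow> coeff f m = 0) \<longrightarrow> (\<forall>m. mdeg m < n \<longrightarrow> coeff (\<psi> f) m = 0)"
    using assms(2) unfolding kcontinuous_def by blast
  show "\<exists>N. \<forall>f. (\<forall>m. mdeg m < N \<longrightarrow> coeff f m = 0) \<longrightarrow> (\<forall>m. mdeg m < n \<longrightarrow> coeff (\<phi> f + \<psi> f) m = 0)"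
    using N1 N2 by (intro exI[of _ "max N1 N2"]) auto
qed

lemma klinear_id: "klinear (\<lambda>f. f)"
  by (simp add: klinear_def)

lemma kcontinuous_id: "kcontinuous (\<lambda>f. f)"
  unfolding kcontinuous_def by blast

lemmas clin_intros = klinear_times_left klinear_times_right kcontinuous_times_left
  kcontinuous_times_right klinear_plus kcontinuous_plus

lemma bilinear_eqI:
  assumes "\<And>g. klinear (\<lambda>f. B f g)" "\<And>g. kcontinuous (\<lambda>f. B f g)"
    and "\<And>f. klinear (B f)" "\<And>f. kcontinuous (B f)"
    and "\<And>g. klinear (\<lambda>f. C f g)" "\<And>g. kcontinuous (\<lambda>f. C f g)"
    and "\<And>f. klinear (C f)" "\<And>f. kcontinuous (C f)"
    and eq: "\<And>a b. B (monom a) (monom b) = C (monom a) (monom b)"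
  shows "B f g = C f g"
proof -
  have B: "B (monom a) = C (monom a)" for a
    by (rule continuous_linear_eqI) (rule assms)+
  have "(\<lambda>f. B f g) = (\<lambda>f. C f g)"
  proof (rule continuous_linear_eqI)
    show "B (monom m) g = C (monom m) g" for m by (simp only: B)
  qed (rule assms)+
  then show ?thesis by (rule fun_cong)
qed

lemma one_times [simp]: "1 * f = (f :: ('m :: graded_umagma, 'k :: field) mseries)"
proof -
  have "(\<lambda>f. 1 * f) = (\<lambda>f :: ('m, 'k) mseries. f)"
    by (rule continuous_linear_eqI; (intro clin_intros klinear_id kcontinuous_id)?)
      (simp add: one_mseries_def monom_mult)
  from fun_cong[OF this, of f] show ?thesis by simp
qed

lemma times_one [simp]: "f * 1 = (f :: ('m :: graded_umagma, 'k :: field) mseries)"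
proof -
  have "(\<lambda>f. f * 1) = (\<lambda>f :: ('m, 'k) mseries. f)"
    by (rule continuous_linear_eqI; (intro clin_intros klinear_id kcontinuous_id)?)
      (simp add: one_mseries_def monom_mult)
  from fun_cong[OF this, of f] show ?thesis by simp
qed

lemma linear_extension:
  fixes u :: "'m :: graded_umagma \<Rightarrow> ('n :: graded_umagma, 'k :: field) mseries"
  assumes u: "\<And>m p. coeff (u m) p \<noteq> 0 \<Longrightarrow> mdeg m = mdeg p + k"
  obtains \<phi> where "klinear \<phi>" "kcontinuous \<phi>" "\<And>m. \<phi> (monom m) = u m"
proof
  define S where "S = (\<lambda>(f :: ('m, 'k) mseries) n. {m. mdeg m = n + k \<and> coeff f m \<noteq> 0})"
  define \<phi> where "\<phi> = (\<lambda>f. Abs_mseries (\<lambda>p. \<Sum>m\<in>S f (mdeg p). coeff f m * coeff (u m) p))"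
  have finS: "finite (S f n)" for f n unfolding S_def by (rule finite_coeff)
  have coeff_\<phi>: "coeff (\<phi> f) p = (\<Sum>m\<in>S f (mdeg p). coeff f m * coeff (u m) p)" for f p
  proof -
    have "finite {p. mdeg p = n \<and> (\<Sum>m\<in>S f (mdeg p). coeff f m * coeff (u m) p) \<noteq> 0}" for n
    proof (rule finite_subset)
      show "{p. mdeg p = n \<and> (\<Sum>m\<in>S f (mdeg p). coeff f m * coeff (u m) p) \<noteq> 0} \<subseteq>
        (\<Union>m\<in>S f n. {p. mdeg p = n \<and> coeff (u m) p \<noteq> 0})"
        by (auto elim!: sum.not_neutral_contains_not_neutral)
    qed (intro finite_UN_I finS finite_coeff)
    from coeff_Abs[OF this] show ?thesis unfolding \<phi>_def by simp
  qed
  have sup: "coeff (\<phi> f) p = (\<Sum>m\<in>A. coeff f m * coeff (u m) p)"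
    if "finite A" "S f (mdeg p) \<subseteq> A" "\<And>m. m \<in> A \<Longrightarrow> mdeg m = mdeg p + k" for f p A
    unfolding coeff_\<phi> by (rule sum.mono_neutral_left) (use that in \<open>auto simp: S_def\<close>)
  show "klinear \<phi>"
    unfolding klinear_def
  proof (intro conjI allI; rule mseries_eqI)
    fix f g :: "('m, 'k) mseries" and p :: 'n
    let ?A = "S f (mdeg p) \<union> S g (mdeg p)"
    have fin: "finite ?A" by (simp add: finS)
    have "coeff (\<phi> (f + g)) p = (\<Sum>m\<in>?A. coeff (f + g) m * coeff (u m) p)"
      by (rule sup[OF fin]) (auto simp: S_def)
    moreover have "coeff (\<phi> f) p = (\<Sum>m\<in>?A. coeff f m * coeff (u m) p)"
      by (rule sup[OF fin]) (auto simp: S_def)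
    moreover have "coeff (\<phi> g) p = (\<Sum>m\<in>?A. coeff g m * coeff (u m) p)"
      by (rule sup[OF fin]) (auto simp: S_def)
    ultimately show "coeff (\<phi> (f + g)) p = coeff (\<phi> f + \<phi> g) p"
      by (simp add: sum.distrib[symmetric] distrib_right)
  next
    fix c and f :: "('m, 'k) mseries" and p :: 'n
    have "coeff (\<phi> (scale c f)) p = (\<Sum>m\<in>S f (mdeg p). coeff (scale c f) m * coeff (u m) p)"
      by (rule sup[OF finS]) (auto simp: S_def)
    then show "coeff (\<phi> (scale c f)) p = coeff (scale c (\<phi> f)) p"
      by (simp add: coeff_\<phi> sum_distrib_left mult.assoc)
  qed
  show "kcontinuous \<phi>"
    unfolding kcontinuous_def
  proof
    fix n
    have "S f (mdeg m) = {}" if "\<forall>m. mdeg m < n + k \<longrightarrow> coeff f m = 0" "mdeg m < n"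
      for f :: "('m, 'k) mseries" and m :: 'n
      using that by (auto simp: S_def)
    then show "\<exists>N. \<forall>f. (\<forall>m. mdeg m < N \<longrightarrow> coeff f m = 0) \<longrightarrow> (\<forall>m. mdeg m < n \<longrightarrow> coeff (\<phi> f) m = 0)"
      by (intro exI[of _ "n + k"]) (auto simp: coeff_\<phi>)
  qed
  show "\<phi> (monom m) = u m" for m
  proof (rule mseries_eqI)
    fix p :: 'n
    have S: "S (monom m) (mdeg p) = (if mdeg m = mdeg p + k then {m} else {})"
      by (auto simp: S_def coeff_monom split: if_splits)
    show "coeff (\<phi> (monom m)) p = coeff (u m) p"
      using u[of m p] by (auto simp: coeff_\<phi> S coeff_monom)
  qed
qed

lemma coeff_times_nonzeroE:
  assumes "coeff (f * g) m \<noteq> 0"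
  obtains a b where "a * b = m" "coeff f a \<noteq> 0" "coeff g b \<noteq> 0"
  using assms unfolding coeff_times by (auto elim!: sum.not_neutral_contains_not_neutral)

lemma ex1_is_coaddition:
  "\<exists>!\<phi> :: ('x, 'k :: field) tree_series \<Rightarrow> ('x, 'k) tensor_series. is_coaddition \<phi>"
proof -
  define w :: "'x mtree \<Rightarrow> ('x, 'k) tensor_series"
    where "w = rec_mtree (\<lambda>x. tensor (var x) 1 + tensor 1 (var x)) (\<lambda>s t a b. a * b)"
  have w_simps: "w (MLeaf x) = tensor (var x) 1 + tensor 1 (var x)" "w (MNode s t) = w s * w t" for x s t
    by (simp_all add: w_def)
  define u where "u = (\<lambda>t. case t of Emp \<Rightarrow> 1 | Tr t \<Rightarrow> w t)"
  have w_deg: "coeff (w t) p \<noteq> 0 \<Longrightarrow> nleaves t = mdeg p" for t p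
  proof (induction t arbitrary: p)
    case (MLeaf x)
    then show ?case
      by (cases p) (auto simp: w_simps var_def one_mseries_def coeff_monom mdeg_prod_def split: if_splits)
  next
    case (MNode s t)
    then obtain a b where "a * b = p" "coeff (w s) a \<noteq> 0" "coeff (w t) b \<noteq> 0"
      unfolding w_simps by (elim coeff_times_nonzeroE)
    with MNode.IH show ?case by fastforce
  qed
  have u_deg: "mdeg t = mdeg p + 0" if "coeff (u t) p \<noteq> 0" for t p
    using that w_deg by (cases t) (auto simp: u_def one_mseries_def coeff_monom split: if_splits)
  have u_mult: "u (a * b) = u a * u b" for a b
    by (cases a; cases b) (simp_all add: u_def w_simps)
  obtain \<phi> where lin: "klinear \<phi>" and cont: "kcontinuous \<phi>" and mon: "\<And>m. \<phi> (monom m) = u m"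
    using linear_extension[of u 0, OF u_deg] by blast
  have mult: "\<phi> (f * g) = \<phi> f * \<phi> g" for f g
    by (rule bilinear_eqI[where B = "\<lambda>f g. \<phi> (f * g)" and C = "\<lambda>f g. \<phi> f * \<phi> g"];
      (intro klinear_comp[OF lin] kcontinuous_comp[OF cont] clin_intros
        klinear_comp[OF _ lin] kcontinuous_comp[OF _ cont])?)
      (simp add: monom_mult mon u_mult)
  show ?thesis
  proof (rule ex1I[of _ \<phi>])
    show "is_coaddition \<phi>"
      using lin cont mult
      by (simp add: is_coaddition_def alg_hom_def mon one_mseries_def[where ?'a = "'x utree"]
        one_utree_def u_def var_def w_simps)
  next
    fix \<psi> :: "('x, 'k) tree_series \<Rightarrow> ('x, 'k) tensor_series" assume \<psi>: "is_coaddition \<psi>"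
    have \<psi>_mult: "\<psi> (f * g) = \<psi> f * \<psi> g" for f g
      using \<psi> by (simp add: is_coaddition_def alg_hom_def)
    have Tr: "\<psi> (monom (Tr t)) = w t" for t
    proof (induction t)
      case (MLeaf x)
      then show ?case using \<psi> by (simp add: is_coaddition_def var_def w_simps)
    next
      case (MNode s t)
      have "\<psi> (monom (Tr (MNode s t))) = \<psi> (monom (Tr s) * monom (Tr t))" by (simp add: monom_mult)
      then show ?case using MNode by (simp add: \<psi>_mult w_simps)
    qed
    have "\<psi> (monom m) = u m" for m
    proof (cases m)
      case Emp
      have "\<psi> 1 = 1" using \<psi> by (simp add: is_coaddition_def alg_hom_def)
      then show ?thesis
        using Emp by (simp add: u_def one_mseries_def[where ?'a = "'x utree"] one_utree_def)
    qed (simp add: u_def Tr)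
    then show "\<psi> = \<phi>"
      using \<psi> lin cont by (intro continuous_linear_eqI) (simp_all add: mon is_coaddition_def alg_hom_def)
  qed
qed

lemma is_coaddition_coadd: "is_coaddition coadd"
  unfolding coadd_def by (rule theI'[OF ex1_is_coaddition])

lemma ex1_is_partial:
  "\<exists>!\<delta> :: ('x, 'k :: field) tree_series \<Rightarrow> ('x, 'k) tree_series. is_partial i \<delta>"
proof -
  define w :: "'x mtree \<Rightarrow> ('x, 'k) tree_series"
    where "w = rec_mtree (\<lambda>x. if x = i then 1 else 0) (\<lambda>s t a b. a * monom (Tr t) + monom (Tr s) * b)"
  have w_simps: "w (MLeaf x) = (if x = i then 1 else 0)"
    "w (MNode s t) = w s * monom (Tr t) + monom (Tr s) * w t" for x s t
    by (simp_all add: w_def)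
  define u where "u = (\<lambda>t. case t of Emp \<Rightarrow> 0 | Tr t \<Rightarrow> w t)"
  have w_deg: "coeff (w t) p \<noteq> 0 \<Longrightarrow> nleaves t = mdeg p + 1" for t p
  proof (induction t arbitrary: p)
    case (MLeaf x)
    then show ?case by (auto simp: w_simps one_mseries_def coeff_monom split: if_splits)
  next
    case (MNode s t)
    have "coeff (w s * monom (Tr t)) p \<noteq> 0 \<or> coeff (monom (Tr s) * w t) p \<noteq> 0"
      using MNode.prems unfolding w_simps coeff_plus' by (metis add_0)
    then consider "coeff (w s * monom (Tr t)) p \<noteq> 0" | "coeff (monom (Tr s) * w t) p \<noteq> 0"
      by blast
    then show ?case
    proof cases
      case 1
      then obtain a b where "a * b = p" "coeff (w s) a \<noteq> 0" "coeff (monom (Tr t) :: ('x, 'k) tree_series) b \<noteq> 0"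
        by (elim coeff_times_nonzeroE)
      with MNode.IH show ?thesis by (fastforce simp: coeff_monom split: if_splits)
    next
      case 2
      then obtain a b where "a * b = p" "coeff (monom (Tr s) :: ('x, 'k) tree_series) a \<noteq> 0" "coeff (w t) b \<noteq> 0"
        by (elim coeff_times_nonzeroE)
      with MNode.IH show ?thesis by (fastforce simp: coeff_monom split: if_splits)
    qed
  qed
  have u_deg: "mdeg t = mdeg p + 1" if "coeff (u t) p \<noteq> 0" for t p
    using that w_deg by (cases t) (auto simp: u_def)
  have Emp: "monom Emp = (1 :: ('x, 'k) tree_series)"
    by (simp add: one_mseries_def one_utree_def)
  have zero: "0 * f = 0" "f * 0 = 0" for f :: "('x, 'k) tree_series"
    by (rule klinear_zero[OF klinear_times_left], rule klinear_zero[OF klinear_times_right])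
  have u_mult: "u (a * b) = u a * monom b + monom a * u b" for a b
    by (cases a; cases b) (simp_all add: u_def w_simps Emp zero)
  obtain \<delta> where lin: "klinear \<delta>" and cont: "kcontinuous \<delta>" and mon: "\<And>m. \<delta> (monom m) = u m"
    using linear_extension[of u 1, OF u_deg] by blast
  have mult: "\<delta> (f * g) = \<delta> f * g + f * \<delta> g" for f g
    by (rule bilinear_eqI[where B = "\<lambda>f g. \<delta> (f * g)" and C = "\<lambda>f g. \<delta> f * g + f * \<delta> g"];
      (intro klinear_comp[OF lin] kcontinuous_comp[OF cont] clin_intros
        klinear_comp[OF _ lin] kcontinuous_comp[OF _ cont])?)
      (simp add: monom_mult mon u_mult)
  show ?thesis
  proof (rule ex1I[of _ \<delta>])
    show "is_partial i \<delta>"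
      using lin cont mult by (simp add: is_partial_def derivation_def mon u_def var_def w_simps)
  next
    fix \<psi> :: "('x, 'k) tree_series \<Rightarrow> ('x, 'k) tree_series" assume \<psi>: "is_partial i \<psi>"
    have \<psi>_mult: "\<psi> (f * g) = \<psi> f * g + f * \<psi> g" for f g
      using \<psi> by (simp add: is_partial_def derivation_def)
    have Tr: "\<psi> (monom (Tr t)) = w t" for t
    proof (induction t)
      case (MLeaf x)
      then show ?case using \<psi> by (simp add: is_partial_def var_def w_simps)
    next
      case (MNode s t)
      have "\<psi> (monom (Tr (MNode s t))) = \<psi> (monom (Tr s) * monom (Tr t))" by (simp add: monom_mult)
      then show ?case using MNode by (simp add: \<psi>_mult w_simps)
    qed
    have "\<psi> 1 = 0" using \<psi>_mult[of 1 1] by simp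
    then have "\<psi> (monom m) = u m" for m
      by (cases m) (simp_all add: u_def Emp Tr)
    then show "\<psi> = \<delta>"
      using \<psi> lin cont by (intro continuous_linear_eqI) (simp_all add: mon is_partial_def derivation_def)
  qed
qed

lemma is_partial_partial: "is_partial i (partial i)"
  unfolding partial_def by (rule theI'[OF ex1_is_partial])

end

theory Submission
  imports Defs
begin

text \<open>Everything rests on one product rule. As \<open>\<Delta>\<close> is an algebra homomorphism, comparing the
  second tensor factors in \<open>\<Delta>(fg) = \<Delta>(f)\<Delta>(g)\<close> gives
  \<open>\<Delta>\<^sub>s(fg) = \<Sum>\<^sub>s\<^sub>=\<^sub>a\<^sub>b \<Delta>\<^sub>a(f) \<Delta>\<^sub>b(g)\<close> (\<open>coadd_part_times\<close>). In the free magma with unit a tree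
  \<open>s\<close> has only the factorizations \<open>s \<cdot> 1\<close>, \<open>1 \<cdot> s\<close> and, if \<open>s = s\<^sub>1s\<^sub>2\<close>, also \<open>s\<^sub>1 \<cdot> s\<^sub>2\<close>. Since
  \<open>\<Delta>\<^sub>1\<close> is the identity, this is the three-term formula for \<open>\<Delta>\<^sub>s(fg)\<close>, and for a leaf it says that
  \<open>\<Delta>\<^sub>x\<close> is a derivation, which its values on the variables identify with the partial derivative.

  All identities between operators are identities between continuous linear maps, so they need to
  be checked on tree monomials only, where one can induct on the tree: verify them on \<open>1\<close> and on
  the variables, and show that they pass from \<open>f\<close> and \<open>g\<close> to \<open>fg\<close>. For the commutation of \<open>\<Delta>\<^sub>s\<close> and
  \<open>\<Delta>\<^sub>t\<close> the last step is an exchange of the sums over the factorizations of \<open>s\<close> and of \<open>t\<close>.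

  The explicit formula for \<open>\<Delta>(t)\<close> and the recursion for \<open>\<mu>\<^sub>s\<close> both come from the fact that a set
  of leaves of \<open>t\<^sub>1t\<^sub>2\<close> is a pair of sets of leaves, along which contraction is multiplicative
  (\<open>sum_Pow_leaves_MNode\<close>, \<open>contract_graft\<close>).

  For the last formula, let \<open>E\<^sub>n\<close> be the sum of the \<open>\<Delta>\<^sub>s\<close> over all \<open>s\<close> of degree \<open>n\<close> in the variable
  \<open>x\<^sub>i\<close>. A pair of such trees (possibly empty) with degrees adding up to \<open>n\<close> is a factorization of
  exactly one tree of degree \<open>n\<close>, hence \<open>E\<^sub>n(fg) = \<Sum>\<^sub>k E\<^sub>k(f) E\<^sub>n\<^sub>-\<^sub>k(g)\<close> (\<open>div_power_times\<close>), the
  Leibniz rule of divided powers. It propagates the identity \<open>D\<^sub>i E\<^sub>n = (n + 1) E\<^sub>n\<^sub>+\<^sub>1\<close> to products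
  (\<open>partial_div_power\<close>), and iterating this identity gives \<open>D\<^sub>i\<^sup>n = n! E\<^sub>n\<close>.\<close>

section \<open>Linear maps on series\<close>

lemma zero_times [simp]: "0 * f = (0 :: ('m :: graded_umagma, 'k :: field) mseries)"
  by (rule klinear_zero[OF klinear_times_left])

lemma times_zero [simp]: "f * 0 = (0 :: ('m :: graded_umagma, 'k :: field) mseries)"
  by (rule klinear_zero[OF klinear_times_right])

lemma sum_times:
  fixes F :: "'a \<Rightarrow> ('m :: graded_umagma, 'k :: field) mseries"
  shows "sum F A * g = (\<Sum>a\<in>A. F a * g)"
  by (rule klinear_sum[OF klinear_times_left])

lemma times_sum:
  fixes F :: "'a \<Rightarrow> ('m :: graded_umagma, 'k :: field) mseries"
  shows "g * sum F A = (\<Sum>a\<in>A. g * F a)"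
  by (rule klinear_sum[OF klinear_times_right])

lemma scale_add: "scale (c + d) f = scale c f + scale d f"
  by (rule mseries_eqI) (simp add: distrib_right)

lemma scale_scale: "scale c (scale d f) = scale (c * d) f"
  by (rule mseries_eqI) (simp add: mult.assoc)

lemma scale_one [simp]: "scale 1 f = f"
  by (rule mseries_eqI) simp

lemma scale_zero [simp]: "scale 0 f = 0"
  by (rule mseries_eqI) simp

lemma scale_zero_right [simp]: "scale c 0 = 0"
  by (rule mseries_eqI) simp

lemma klinear_scale_const: "klinear (scale c)"
  by (auto simp: klinear_def distrib_left mult_ac intro!: mseries_eqI)

lemma kcontinuous_scale_const: "kcontinuous (scale c)"
  unfolding kcontinuous_def by (metis coeff_scale mult_zero_right)

lemma klinear_sum_fun:
  assumes "\<And>a. a \<in> A \<Longrightarrow> klinear (\<phi> a)"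
  shows "klinear (\<lambda>f. \<Sum>a\<in>A. \<phi> a f)"
  using assms
proof (induction A rule: infinite_finite_induct)
  case (insert a A)
  then show ?case by (simp add: klinear_plus)
qed (simp_all add: klinear_def)

lemma kcontinuous_sum_fun:
  assumes "\<And>a. a \<in> A \<Longrightarrow> kcontinuous (\<phi> a)"
  shows "kcontinuous (\<lambda>f. \<Sum>a\<in>A. \<phi> a f)"
  using assms
proof (induction A rule: infinite_finite_induct)
  case (insert a A)
  then show ?case by (simp add: kcontinuous_plus)
qed (simp_all add: kcontinuous_def)

lemma tensor_monom: "tensor (monom a) (monom b) = monom (a, b)"
proof (rule mseries_eqI)
  fix p show "coeff (tensor (monom a) (monom b)) p = coeff (monom (a, b)) p"
    by (cases p) (simp add: coeff_monom)
qed

section \<open>Factorizations of trees\<close>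

definition factorizations :: "'m :: times \<Rightarrow> ('m \<times> 'm) set" where
  "factorizations s = {(a, b). a * b = s}"

lemma utree_times_eq_one_iff [simp]: "a * b = (1 :: 'x utree) \<longleftrightarrow> a = 1 \<and> b = 1"
  by (cases a; cases b) (auto simp: one_utree_def)

lemma Tr_neq_one [simp]: "Tr t \<noteq> 1" "1 \<noteq> Tr t"
  by (simp_all add: one_utree_def)

lemma factorizations_one: "factorizations (1 :: 'x utree) = {(1, 1)}"
  by (auto simp: factorizations_def)

lemma factorizations_MLeaf: "factorizations (Tr (MLeaf i)) = {(Tr (MLeaf i), 1), (1, Tr (MLeaf i))}"
proof -
  have "a * b = Tr (MLeaf i) \<longleftrightarrow> a = Tr (MLeaf i) \<and> b = 1 \<or> a = 1 \<and> b = Tr (MLeaf i)" for a b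
    by (cases a; cases b) (auto simp: one_utree_def)
  then show ?thesis by (auto simp: factorizations_def)
qed

lemma factorizations_MNode:
  "factorizations (Tr (MNode s t)) = {(Tr (MNode s t), 1), (1, Tr (MNode s t)), (Tr s, Tr t)}"
proof -
  have "a * b = Tr (MNode s t) \<longleftrightarrow>
    a = Tr (MNode s t) \<and> b = 1 \<or> a = 1 \<and> b = Tr (MNode s t) \<or> a = Tr s \<and> b = Tr t" for a b
    by (cases a; cases b) (auto simp: one_utree_def)
  then show ?thesis by (auto simp: factorizations_def)
qed

lemma finite_factorizations [simp]: "finite (factorizations (s :: 'x utree))"
proof (cases s)
  case Emp
  then show ?thesis by (simp add: factorizations_one[unfolded one_utree_def])
next
  case (Tr t)
  then show ?thesis by (cases t) (simp_all add: factorizations_MLeaf factorizations_MNode)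
qed

section \<open>The product rule for the components of the co-addition\<close>

text \<open>Picking the coefficient of \<open>s\<close> in the second tensor factor makes sense for every tensor series,
  not only for those of the form \<open>\<Delta>(f)\<close>. In this generality the product rule is a statement about
  a continuous bilinear map, and so can be checked on monomials.\<close>

definition slice :: "'n \<Rightarrow> ('m :: graded_umagma \<times> 'n :: graded_umagma, 'k :: field) mseries \<Rightarrow> ('m, 'k) mseries" where
  "slice s F = Abs_mseries (\<lambda>a. coeff F (a, s))"

lemma coeff_slice: "coeff (slice s F) a = coeff F (a, s)"
proof -
  have "finite {a. mdeg a = n \<and> coeff F (a, s) \<noteq> 0}" for n
  proof (rule finite_imageD)
    show "finite ((\<lambda>a. (a, s)) ` {a. mdeg a = n \<and> coeff F (a, s) \<noteq> 0})"
      by (rule finite_subset[OF _ finite_coeff[of "n + mdeg s" F]]) (auto simp: mdeg_prod_def)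
  qed (auto simp: inj_on_def)
  from coeff_Abs[OF this] show ?thesis unfolding slice_def by simp
qed

lemma klinear_slice: "klinear (slice s)"
  by (auto simp: klinear_def coeff_slice intro!: mseries_eqI)

lemma kcontinuous_slice: "kcontinuous (slice s)"
  unfolding kcontinuous_def
proof
  fix n
  show "\<exists>N. \<forall>F. (\<forall>m. mdeg m < N \<longrightarrow> coeff F m = 0) \<longrightarrow> (\<forall>m. mdeg m < n \<longrightarrow> coeff (slice s F) m = 0)"
    by (intro exI[of _ "n + mdeg s"]) (simp add: coeff_slice mdeg_prod_def)
qed

lemma slice_monom: "slice s (monom (a, b)) = (if b = s then monom a else 0)"
  by (rule mseries_eqI) (simp add: coeff_slice coeff_monom)

text \<open>For monomials \<open>F = a \<otimes> b\<close> and \<open>G = c \<otimes> d\<close> the only factorization of \<open>s\<close> that can contribute to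
  the right hand side is \<open>(b, d)\<close>.\<close>

lemma slice_times:
  fixes F G :: "('x, 'k :: field) tensor_series"
  shows "slice s (F * G) = (\<Sum>p\<in>factorizations s. slice (fst p) F * slice (snd p) G)"
proof (rule bilinear_eqI[where B = "\<lambda>F G. slice s (F * G)"
      and C = "\<lambda>F G. \<Sum>p\<in>factorizations s. slice (fst p) F * slice (snd p) G"])
  fix p q :: "'x utree \<times> 'x utree"
  obtain a b c d where [simp]: "p = (a, b)" "q = (c, d)" by fastforce
  have "(\<Sum>p\<in>factorizations s. slice (fst p) (monom (a, b)) * slice (snd p) (monom (c, d)))
    = (\<Sum>p\<in>factorizations s. if (b, d) = p then monom (a * c) else (0 :: ('x, 'k) tree_series))"
    by (rule sum.cong) (auto simp: slice_monom monom_mult)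
  also have "\<dots> = slice s (monom (p * q))"
    by (simp add: times_prod_def slice_monom) (simp add: factorizations_def)
  finally show "slice s (monom p * monom q) =
      (\<Sum>p'\<in>factorizations s. slice (fst p') (monom p) * (slice (snd p') (monom q) :: ('x, 'k) tree_series))"
    by (simp add: monom_mult)
next
  fix G
  show "klinear (\<lambda>F. slice s (F * G))"
    by (rule klinear_comp[OF klinear_slice klinear_times_left])
  show "kcontinuous (\<lambda>F. slice s (F * G))"
    by (rule kcontinuous_comp[OF kcontinuous_slice kcontinuous_times_left])
  show "klinear (\<lambda>F. \<Sum>p\<in>factorizations s. slice (fst p) F * slice (snd p) G)"
    by (rule klinear_sum_fun) (rule klinear_comp[OF klinear_times_left klinear_slice])
  show "kcontinuous (\<lambda>F. \<Sum>p\<in>factorizations s. slice (fst p) F * slice (snd p) G)"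
    by (rule kcontinuous_sum_fun) (rule kcontinuous_comp[OF kcontinuous_times_left kcontinuous_slice])
next
  fix F
  show "klinear (\<lambda>G. slice s (F * G))"
    by (rule klinear_comp[OF klinear_slice klinear_times_right])
  show "kcontinuous (\<lambda>G. slice s (F * G))"
    by (rule kcontinuous_comp[OF kcontinuous_slice kcontinuous_times_right])
  show "klinear (\<lambda>G. \<Sum>p\<in>factorizations s. slice (fst p) F * slice (snd p) G)"
    by (rule klinear_sum_fun) (rule klinear_comp[OF klinear_times_right klinear_slice])
  show "kcontinuous (\<lambda>G. \<Sum>p\<in>factorizations s. slice (fst p) F * slice (snd p) G)"
    by (rule kcontinuous_sum_fun) (rule kcontinuous_comp[OF kcontinuous_times_right kcontinuous_slice])
qed

text \<open>\<open>\<Delta>\<^sub>s\<close> inherits linearity, continuity and the product rule from \<open>\<Delta>\<close> and \<open>slice s\<close>.\<close>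

lemma coadd_part_eq_slice: "coadd_part s f = slice s (coadd f)"
  by (simp add: coadd_part_def slice_def)

lemma coadd_times: "coadd (f * g) = coadd f * coadd g"
  and coadd_one: "coadd 1 = 1"
  and coadd_var: "coadd (var i) = tensor (var i) 1 + tensor 1 (var i)"
  and klinear_coadd: "klinear coadd"
  and kcontinuous_coadd: "kcontinuous coadd"
  using is_coaddition_coadd by (auto simp: is_coaddition_def alg_hom_def)

lemma klinear_coadd_part: "klinear (coadd_part s)"
  unfolding coadd_part_eq_slice[abs_def] by (rule klinear_comp[OF klinear_slice klinear_coadd])

lemma kcontinuous_coadd_part: "kcontinuous (coadd_part s)"
  unfolding coadd_part_eq_slice[abs_def] by (rule kcontinuous_comp[OF kcontinuous_slice kcontinuous_coadd])

lemma coadd_part_times: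
  "coadd_part s (f * g) = (\<Sum>p\<in>factorizations s. coadd_part (fst p) f * coadd_part (snd p) g)"
  by (simp add: coadd_part_eq_slice coadd_times slice_times)

lemma coadd_part_of_one: "coadd_part s 1 = (if s = 1 then 1 else 0)"
  unfolding coadd_part_eq_slice coadd_one by (auto simp: one_mseries_def one_prod_def slice_monom)

lemma coadd_part_var:
  "coadd_part s (var i) = (if s = 1 then var i else if s = Tr (MLeaf i) then 1 else 0)"
  unfolding coadd_part_eq_slice coadd_var
  by (auto simp: var_def one_mseries_def tensor_monom slice_monom klinear_add[OF klinear_slice])

text \<open>As \<open>M(X) \<union> {1}\<close> is generated by the variables under multiplication, properties of tree
  monomials can be proved without mentioning trees.\<close>

lemma tree_monomial_induct [case_names one var times]:
  fixes P :: "('x, 'k :: field) tree_series \<Rightarrow> bool"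
  assumes one: "P 1" and var: "\<And>i. P (var i)" and times: "\<And>f g. P f \<Longrightarrow> P g \<Longrightarrow> P (f * g)"
  shows "P (monom m)"
proof (cases m)
  case Emp
  then show ?thesis using one by (simp add: one_mseries_def one_utree_def)
next
  case (Tr t)
  have "P (monom (Tr t))"
  proof (induction t)
    case (MLeaf i)
    then show ?case using var by (simp add: var_def)
  next
    case (MNode s t)
    then show ?case using times[OF MNode] by (simp add: monom_mult)
  qed
  with Tr show ?thesis by simp
qed

text \<open>By the product rule \<open>\<Delta>\<^sub>1\<close> is a homomorphism, since \<open>1 = 1 \<cdot> 1\<close> is the only factorization of \<open>1\<close>;
  and it fixes the variables.\<close>

lemma coadd_part_one:
  fixes f :: "('x, 'k :: field) tree_series"
  shows "coadd_part 1 f = f"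
proof -
  have "coadd_part 1 (monom m) = (monom m :: ('x, 'k) tree_series)" for m
    by (induction m rule: tree_monomial_induct)
      (simp_all add: coadd_part_of_one coadd_part_var coadd_part_times factorizations_one)
  then have "coadd_part 1 = (\<lambda>f :: ('x, 'k) tree_series. f)"
    by (intro continuous_linear_eqI klinear_coadd_part kcontinuous_coadd_part klinear_id kcontinuous_id)
  from fun_cong[OF this, of f] show ?thesis .
qed

lemma coadd_part_MNode_times:
  "coadd_part (Tr (MNode s t)) (f * g) =
     coadd_part (Tr (MNode s t)) f * g + f * coadd_part (Tr (MNode s t)) g
     + coadd_part (Tr s) f * coadd_part (Tr t) g"
  by (simp add: coadd_part_times factorizations_MNode coadd_part_one)

text \<open>A leaf has only the two trivial factorizations, so that the product rule is the Leibniz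
  rule, and the derivation \<open>D\<^sub>i\<close> is determined by its values on the variables.\<close>

lemma coadd_part_MLeaf:
  "coadd_part (Tr (MLeaf i)) = (partial i :: ('x, 'k :: field) tree_series \<Rightarrow> _)"
proof -
  let ?D = "coadd_part (Tr (MLeaf i)) :: ('x, 'k) tree_series \<Rightarrow> _"
  have "derivation ?D"
    by (simp add: derivation_def klinear_coadd_part coadd_part_times factorizations_MLeaf coadd_part_one)
  moreover have "?D (var j) = (if j = i then 1 else 0)" for j
    by (simp add: coadd_part_var)
  ultimately have "is_partial i ?D"
    by (simp add: is_partial_def kcontinuous_coadd_part)
  then show ?thesis
    unfolding partial_def by (rule the1_equality[OF ex1_is_partial, symmetric])
qed

text \<open>Both sides expand into the double sum of
  \<open>\<Delta>\<^sub>a\<Delta>\<^sub>c(f) \<Delta>\<^sub>b\<Delta>\<^sub>d(g)\<close> over the factorizations \<open>s = ab\<close> and \<open>t = cd\<close>. Even for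
  nonempty \<open>s\<close> and \<open>t\<close> empty factors occur here, so commutation is assumed for all of them.\<close>

lemma coadd_part_commute_times:
  assumes f: "\<And>s t. coadd_part s (coadd_part t f) = coadd_part t (coadd_part s f)"
    and g: "\<And>s t. coadd_part s (coadd_part t g) = coadd_part t (coadd_part s g)"
  shows "coadd_part s (coadd_part t (f * g)) = coadd_part t (coadd_part s (f * g))"
proof -
  have "coadd_part s (coadd_part t (f * g)) = (\<Sum>p\<in>factorizations t. \<Sum>q\<in>factorizations s.
      coadd_part (fst q) (coadd_part (fst p) f) * coadd_part (snd q) (coadd_part (snd p) g))" for s t
    by (simp add: coadd_part_times klinear_sum[OF klinear_coadd_part])
  note expand = this
  show ?thesis
    unfolding expand by (subst sum.swap) (simp add: f g)
qed

lemma coadd_part_commute: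
  fixes f :: "('x, 'k :: field) tree_series"
  shows "coadd_part s (coadd_part t f) = coadd_part t (coadd_part s f)"
proof -
  have "coadd_part s (coadd_part t (monom m)) = coadd_part t (coadd_part s (monom m :: ('x, 'k) tree_series))"
    for s t m
  proof (induction m arbitrary: s t rule: tree_monomial_induct)
    case (times f g)
    show ?case by (rule coadd_part_commute_times) (rule times)+
  qed (auto simp: coadd_part_of_one coadd_part_var klinear_zero[OF klinear_coadd_part])
  then have "(\<lambda>f :: ('x, 'k) tree_series. coadd_part s (coadd_part t f)) = (\<lambda>f. coadd_part t (coadd_part s f))"
    by (intro continuous_linear_eqI klinear_comp[OF klinear_coadd_part klinear_coadd_part]
        kcontinuous_comp[OF kcontinuous_coadd_part kcontinuous_coadd_part])
  from fun_cong[OF this, of f] show ?thesis .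
qed

section \<open>Contractions\<close>

text \<open>This is the bijection from pairs of sets of leaves of \<open>s\<close> and \<open>t\<close> to sets of leaves of \<open>st\<close>.
  It is compatible with contractions and complements.\<close>

definition graft :: "bool list set \<Rightarrow> bool list set \<Rightarrow> bool list set" where
  "graft I J = (#) False ` I \<union> (#) True ` J"

lemma sum_Pow_leaves_MNode:
  "(\<Sum>I\<in>Pow (leaves (MNode s t)). F I) = (\<Sum>I\<in>Pow (leaves s). \<Sum>J\<in>Pow (leaves t). F (graft I J))"
proof -
  have "(\<Sum>I\<in>Pow (leaves (MNode s t)). F I) = (\<Sum>(I, J)\<in>Pow (leaves s) \<times> Pow (leaves t). F (graft I J))"
  proof (rule sum.reindex_bij_witness[where i = "\<lambda>(I, J). graft I J"
        and j = "\<lambda>I. ({p. False # p \<in> I}, {p. True # p \<in> I})"])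
    fix I assume I: "I \<in> Pow (leaves (MNode s t))"
    have "p \<in> graft {p. False # p \<in> I} {p. True # p \<in> I} \<longleftrightarrow> p \<in> I" for p
      using I by (cases p) (auto simp: graft_def)
    then have eq: "graft {p. False # p \<in> I} {p. True # p \<in> I} = I" by blast
    then show "(case ({p. False # p \<in> I}, {p. True # p \<in> I}) of (I, J) \<Rightarrow> graft I J) = I"
      and "(case ({p. False # p \<in> I}, {p. True # p \<in> I}) of (I, J) \<Rightarrow> F (graft I J)) = F I" by simp_all
    show "({p. False # p \<in> I}, {p. True # p \<in> I}) \<in> Pow (leaves s) \<times> Pow (leaves t)"
      using I by auto
  qed (auto simp: graft_def)
  then show ?thesis by (simp add: sum.cartesian_product)
qed

lemma contract_graft: "contract (MNode s t) (graft I J) = contract s I * contract t J"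
proof -
  have "{p. False # p \<in> graft I J} = I" "{p. True # p \<in> graft I J} = J" by (auto simp: graft_def)
  then show ?thesis by simp
qed

lemma leaves_Diff_graft: "leaves (MNode s t) - graft I J = graft (leaves s - I) (leaves t - J)"
  by (auto simp: graft_def)

lemma coadd_monom_Tr:
  "(coadd (monom (Tr t)) :: ('x, 'k :: field) tensor_series) =
    (\<Sum>I\<in>Pow (leaves t). monom (contract t I, contract t (leaves t - I)))"
proof (induction t)
  case (MLeaf i)
  have "Pow {[] :: bool list} = {{}, {[]}}" by blast
  then show ?case
    using coadd_var[of i] by (simp add: var_def one_mseries_def tensor_monom add.commute)
next
  case (MNode s t)
  have "(coadd (monom (Tr (MNode s t))) :: ('x, 'k) tensor_series) =
      coadd (monom (Tr s)) * coadd (monom (Tr t))"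
    by (simp add: monom_mult flip: coadd_times)
  then show ?case
    unfolding sum_Pow_leaves_MNode contract_graft leaves_Diff_graft
    by (simp only: MNode sum_times) (simp add: times_sum monom_mult times_prod_def)
qed

text \<open>Only the sets \<open>I\<close> with \<open>t|I\<^sup>c = s\<close> contribute to \<open>\<Delta>\<^sub>s(t)\<close>. The complements of \<open>s\<close> index the sum
  because the values \<open>t|I\<close> for these \<open>I\<close> are exactly the complements.\<close>

lemma coadd_part_monom_Tr:
  "(coadd_part s (monom (Tr t)) :: ('x, 'k :: field) tree_series) =
    (\<Sum>s'\<in>complements s t. scale (of_nat (compl_mult_in s s' t)) (monom s'))"
proof (rule mseries_eqI)
  fix a :: "'x utree"
  let ?Q = "{I. I \<subseteq> leaves t \<and> contract t I = a \<and> contract t (leaves t - I) = s}"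
  have fin: "finite (complements s t)"
    by (rule finite_subset[of _ "(\<lambda>I. contract t (leaves t - I)) ` Pow (leaves t)"])
      (auto simp: complements_def)
  (* if I lies in ?Q, then its complement in leaves t exhibits a as a complement of s *)
  have empty: "?Q = {}" if "a \<notin> complements s t"
  proof -
    have "a \<in> complements s t" if "I \<in> ?Q" for I
      using that by (auto simp: complements_def double_diff intro!: exI[of _ "leaves t - I"])
    with that show ?thesis by blast
  qed
  have "coeff (coadd_part s (monom (Tr t))) a =
    (\<Sum>I\<in>Pow (leaves t). if contract t I = a \<and> contract t (leaves t - I) = s then 1 else (0 :: 'k))"
    by (auto simp: coeff_coadd_part coadd_monom_Tr coeff_sum coeff_monom intro!: sum.cong)
  also have "\<dots> = of_nat (card ?Q)"
    by (simp add: sum.If_cases Int_def)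
  also have "\<dots> = (\<Sum>s'\<in>complements s t. if a = s' then of_nat (card ?Q) else 0)"
    using fin by (cases "a \<in> complements s t") (simp_all only: empty sum.delta' card.empty of_nat_0 if_True if_False not_False_eq_True)
  also have "\<dots> = coeff (\<Sum>s'\<in>complements s t. scale (of_nat (compl_mult_in s s' t)) (monom s')) a"
    by (auto simp: coeff_sum coeff_monom compl_mult_in_def intro!: sum.cong)
  finally show "coeff (coadd_part s (monom (Tr t)) :: ('x, 'k) tree_series) a =
    coeff (\<Sum>s'\<in>complements s t. scale (of_nat (compl_mult_in s s' t)) (monom s')) a" .
qed

text \<open>The set counted by \<open>compl_mult_in s s' t\<close> consists of those \<open>I\<close> counted by \<open>mult_in s' t\<close> for
  which the complementary contraction is \<open>s\<close>; under the hypothesis this is no restriction.\<close>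

lemma compl_mult_in_eq_mult_in:
  assumes "complements s' t = {s}"
  shows "compl_mult_in s s' t = mult_in s' t"
proof -
  have "contract t (leaves t - I) = s" if "I \<subseteq> leaves t" "contract t I = s'" for I
    using that assms unfolding complements_def by blast
  then show ?thesis
    unfolding compl_mult_in_def mult_in_def by (intro arg_cong[of _ _ card]) blast
qed

lemma mult_in_eq_sum: "mult_in s t = (\<Sum>I\<in>Pow (leaves t). if contract t I = s then 1 else 0)"
  by (simp add: mult_in_def sum.If_cases Int_def)

lemma contract_eq_one_iff: "I \<subseteq> leaves t \<Longrightarrow> contract t I = 1 \<longleftrightarrow> I = {}"
proof (induction t arbitrary: I)
  case (MLeaf x)
  then show ?case by auto
next
  case (MNode s t)
  have "{p. False # p \<in> I} \<subseteq> leaves s" "{p. True # p \<in> I} \<subseteq> leaves t"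
    using MNode.prems by auto
  then have "contract (MNode s t) I = 1 \<longleftrightarrow> {p. False # p \<in> I} = {} \<and> {p. True # p \<in> I} = {}"
    by (simp only: contract.simps utree_times_eq_one_iff MNode.IH)
  also have "\<dots> \<longleftrightarrow> I = {}"
    using MNode.prems by auto
  finally show ?case .
qed

lemma mult_in_one: "mult_in 1 t = 1"
proof -
  have "{I. I \<subseteq> leaves t \<and> contract t I = 1} = {{}}"
    by (auto simp: contract_eq_one_iff contract_empty)
  then show ?thesis by (simp add: mult_in_def)
qed

text \<open>The counterpart for \<open>\<mu>\<close> of the product rule: choosing leaves of \<open>t\<^sub>1t\<^sub>2\<close> that contract to \<open>s\<close>
  means choosing leaves of \<open>t\<^sub>1\<close> and of \<open>t\<^sub>2\<close> that contract to the two factors of a factorization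
  of \<open>s\<close>.\<close>

lemma mult_in_MNode:
  "mult_in s (MNode t1 t2) = (\<Sum>p\<in>factorizations s. mult_in (fst p) t1 * mult_in (snd p) t2)"
proof -
  have "(\<Sum>p\<in>factorizations s. mult_in (fst p) t1 * mult_in (snd p) t2) =
    (\<Sum>p\<in>factorizations s. \<Sum>I\<in>Pow (leaves t1). \<Sum>J\<in>Pow (leaves t2).
      if (contract t1 I, contract t2 J) = p then 1 else 0)"
    unfolding mult_in_eq_sum sum_product by (intro sum.cong) auto
  also have "\<dots> = (\<Sum>I\<in>Pow (leaves t1). \<Sum>J\<in>Pow (leaves t2). \<Sum>p\<in>factorizations s.
      if (contract t1 I, contract t2 J) = p then 1 else 0)"
    by (subst sum.swap, subst (2) sum.swap) (rule refl)
  also have "\<dots> = mult_in s (MNode t1 t2)"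
    unfolding mult_in_eq_sum sum_Pow_leaves_MNode contract_graft
    by simp (simp add: factorizations_def)
  finally show ?thesis ..
qed

section \<open>Trees in one variable and divided powers\<close>

text \<open>The empty tree is admitted because it occurs in the trivial factorizations of every tree.\<close>

definition one_var_utrees :: "'x \<Rightarrow> nat \<Rightarrow> 'x utree set" where
  "one_var_utrees i n = {s. set_utree s \<subseteq> {i} \<and> mdeg s = n}"

lemma nleaves_pos: "0 < nleaves t"
  by (induction t) auto

lemma mdeg_eq_0_iff: "mdeg s = 0 \<longleftrightarrow> s = (1 :: 'x utree)"
  using nleaves_pos by (cases s) (auto simp: one_utree_def)

lemma set_utree_times_subset_iff: "set_utree (a * b) \<subseteq> A \<longleftrightarrow> set_utree a \<subseteq> A \<and> set_utree b \<subseteq> A"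
  by (cases a; cases b) simp_all

lemma finite_one_var_trees: "finite (one_var_trees i n)"
proof (induction n rule: less_induct)
  case (less n)
  have "one_var_trees i n \<subseteq>
    insert (MLeaf i) (\<Union>k<n. \<Union>l<n. (\<lambda>(s, t). MNode s t) ` (one_var_trees i k \<times> one_var_trees i l))"
  proof
    fix s assume s: "s \<in> one_var_trees i n"
    show "s \<in> insert (MLeaf i) (\<Union>k<n. \<Union>l<n. (\<lambda>(s, t). MNode s t) ` (one_var_trees i k \<times> one_var_trees i l))"
    proof (cases s)
      case (MNode a b)
      then show ?thesis
        using s nleaves_pos[of a] nleaves_pos[of b] by (auto simp: one_var_trees_def image_iff)
    qed (use s in \<open>auto simp: one_var_trees_def\<close>)
  qed
  moreover have "finite (insert (MLeaf i) (\<Union>k<n. \<Union>l<n. (\<lambda>(s, t). MNode s t) ` (one_var_trees i k \<times> one_var_trees i l)))"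
    using less by auto
  ultimately show ?case by (rule finite_subset)
qed

lemma one_var_utrees_0: "one_var_utrees i 0 = {1}"
  by (auto simp: one_var_utrees_def mdeg_eq_0_iff one_utree_def)

lemma one_var_utrees_pos: "n \<ge> 1 \<Longrightarrow> one_var_utrees i n = Tr ` one_var_trees i n"
proof (intro set_eqI)
  fix s assume "n \<ge> 1"
  then show "s \<in> one_var_utrees i n \<longleftrightarrow> s \<in> Tr ` one_var_trees i n"
    by (cases s) (auto simp: one_var_utrees_def one_var_trees_def)
qed

lemma finite_one_var_utrees [simp]: "finite (one_var_utrees i n)"
  by (cases n) (simp_all add: one_var_utrees_0 one_var_utrees_pos finite_one_var_trees)

lemma one_var_utrees_1: "one_var_utrees i 1 = {Tr (MLeaf i)}"
proof -
  have "nleaves s = 1 \<longleftrightarrow> (\<exists>x. s = MLeaf x)" for s :: "'a mtree"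
  proof (cases s)
    case (MNode a b)
    then show ?thesis using nleaves_pos[of a] nleaves_pos[of b] by auto
  qed simp
  then have "one_var_trees i 1 = {MLeaf i}" by (auto simp: one_var_trees_def)
  then show ?thesis by (simp add: one_var_utrees_pos)
qed

lemma times_in_one_var_utrees_iff:
  "a * b \<in> one_var_utrees i n \<longleftrightarrow>
    mdeg a \<le> n \<and> a \<in> one_var_utrees i (mdeg a) \<and> b \<in> one_var_utrees i (n - mdeg a)"
  by (auto simp only: one_var_utrees_def mem_Collect_eq set_utree_times_subset_iff mdeg_mult)

text \<open>This sum turns out to be the divided power \<open>D\<^sub>i\<^sup>n/n!\<close>, whence the name.\<close>

definition div_power :: "'x \<Rightarrow> nat \<Rightarrow> ('x, 'k :: field) tree_series \<Rightarrow> ('x, 'k) tree_series" where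
  "div_power i n f = (\<Sum>s\<in>one_var_utrees i n. coadd_part s f)"

lemma klinear_div_power: "klinear (div_power i n)"
  unfolding div_power_def[abs_def] by (intro klinear_sum_fun klinear_coadd_part)

lemma kcontinuous_div_power: "kcontinuous (div_power i n)"
  unfolding div_power_def[abs_def] by (intro kcontinuous_sum_fun kcontinuous_coadd_part)

lemma div_power_0: "div_power i 0 f = f"
  by (simp add: div_power_def one_var_utrees_0 coadd_part_one)

lemma div_power_1: "div_power i 1 = partial i"
  by (simp add: div_power_def[abs_def] one_var_utrees_1 coadd_part_MLeaf del: One_nat_def)

lemma partial_times: "partial i (f * g) = partial i f * g + f * partial i g"
  using is_partial_partial[of i] unfolding is_partial_def derivation_def by blast

lemma partial_var: "partial i (var j) = (if j = i then 1 else 0)"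
  using is_partial_partial[of i] unfolding is_partial_def by blast

lemma klinear_partial: "klinear (partial i)"
  using is_partial_partial[of i] unfolding is_partial_def derivation_def by blast

lemma kcontinuous_partial: "kcontinuous (partial i)"
  using is_partial_partial[of i] unfolding is_partial_def by blast

lemma partial_one: "partial i 1 = 0"
  using partial_times[of i 1 1] by simp

lemma div_power_one: "div_power i (Suc n) 1 = 0"
  unfolding div_power_def
  by (rule sum.neutral) (auto simp: one_var_utrees_def coadd_part_of_one)

lemma div_power_var: "div_power i (Suc (Suc n)) (var j) = 0"
  unfolding div_power_def
  by (rule sum.neutral) (auto simp: one_var_utrees_def coadd_part_var)

text \<open>Applying the product rule to each \<open>\<Delta>\<^sub>s\<close> gives a sum over all pairs \<open>(s, (a, b))\<close> with
  \<open>s = ab\<close>. Here \<open>s\<close> can be recovered from \<open>(a, b)\<close>, so the pairs \<open>(a, b)\<close> alone can be sorted by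
  the degree \<open>k\<close> of \<open>a\<close>.\<close>

lemma div_power_times: "div_power i n (f * g) = (\<Sum>k\<le>n. div_power i k f * div_power i (n - k) g)"
proof -
  let ?F = "\<lambda>p. coadd_part (fst p) f * coadd_part (snd p) g"
  have "div_power i n (f * g) = (\<Sum>s\<in>one_var_utrees i n. \<Sum>p\<in>factorizations s. ?F p)"
    by (simp only: div_power_def coadd_part_times)
  also have "\<dots> = (\<Sum>(s, p)\<in>Sigma (one_var_utrees i n) factorizations. ?F p)"
    by (rule sum.Sigma) auto
  also have "\<dots> = (\<Sum>(k, p)\<in>Sigma {..n} (\<lambda>k. one_var_utrees i k \<times> one_var_utrees i (n - k)). ?F p)"
  proof (rule sum.reindex_bij_witness[where j = "\<lambda>(s, p). (mdeg (fst p), p)"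
        and i = "\<lambda>(k, p). (fst p * snd p, p)"])
    fix q assume "q \<in> Sigma {..n} (\<lambda>k. one_var_utrees i k \<times> one_var_utrees i (n - k))"
    then obtain k a b where "q = (k, (a, b))" "k \<le> n" "a \<in> one_var_utrees i k" "b \<in> one_var_utrees i (n - k)"
      by auto
    moreover from this have "mdeg a = k" by (simp add: one_var_utrees_def)
    ultimately show "(case (case q of (k, p) \<Rightarrow> (fst p * snd p, p)) of (s, p) \<Rightarrow> (mdeg (fst p), p)) = q"
      and "(case q of (k, p) \<Rightarrow> (fst p * snd p, p)) \<in> Sigma (one_var_utrees i n) factorizations"
      by (simp_all add: factorizations_def times_in_one_var_utrees_iff)
  qed (auto simp: factorizations_def times_in_one_var_utrees_iff)
  also have "\<dots> = (\<Sum>k\<le>n. \<Sum>p\<in>one_var_utrees i k \<times> one_var_utrees i (n - k). ?F p)"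
    by (subst sum.Sigma) auto
  also have "\<dots> = (\<Sum>k\<le>n. div_power i k f * div_power i (n - k) g)"
    by (simp only: div_power_def sum_times) (simp add: times_sum sum.cartesian_product case_prod_unfold)
  finally show ?thesis .
qed

text \<open>In \<open>D\<^sub>i E\<^sub>n(fg)\<close> the product \<open>E\<^sub>k(f) E\<^sub>n\<^sub>+\<^sub>1\<^sub>-\<^sub>k(g)\<close> arises from differentiating the first factor
  of \<open>E\<^sub>k\<^sub>-\<^sub>1(f) E\<^sub>n\<^sub>+\<^sub>1\<^sub>-\<^sub>k(g)\<close> and the second factor of \<open>E\<^sub>k(f) E\<^sub>n\<^sub>-\<^sub>k(g)\<close>, with coefficients \<open>k\<close> and
  \<open>n + 1 - k\<close>. Their sum does not depend on \<open>k\<close>.\<close>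

lemma partial_div_power_times:
  assumes f: "\<And>n. partial i (div_power i n f) = scale (of_nat (Suc n)) (div_power i (Suc n) f)"
    and g: "\<And>n. partial i (div_power i n g) = scale (of_nat (Suc n)) (div_power i (Suc n) g)"
  shows "partial i (div_power i n (f * g)) = scale (of_nat (Suc n)) (div_power i (Suc n) (f * g))"
proof -
  let ?H = "\<lambda>k. div_power i k f * div_power i (Suc n - k) g"
  have "partial i (div_power i n (f * g)) =
    (\<Sum>k\<le>n. scale (of_nat (Suc k)) (?H (Suc k))) + (\<Sum>k\<le>n. scale (of_nat (Suc n - k)) (?H k))"
    unfolding div_power_times klinear_sum[OF klinear_partial] sum.distrib[symmetric]
  proof (rule sum.cong[OF refl])
    fix k assume "k \<in> {..n}"
    then have "Suc n - k = Suc (n - k)" by (simp add: Suc_diff_le)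
    then show "partial i (div_power i k f * div_power i (n - k) g) =
        scale (of_nat (Suc k)) (?H (Suc k)) + scale (of_nat (Suc n - k)) (?H k)"
      by (simp only: partial_times f g scale_times_left scale_times_right diff_Suc_Suc)
  qed
  (* both sums may run up to n + 1, as the additional terms have coefficient 0 *)
  also have "(\<Sum>k\<le>n. scale (of_nat (Suc k)) (?H (Suc k))) = (\<Sum>k\<le>Suc n. scale (of_nat k) (?H k))"
    by (subst sum.atMost_Suc_shift) simp
  also have "(\<Sum>k\<le>n. scale (of_nat (Suc n - k)) (?H k)) = (\<Sum>k\<le>Suc n. scale (of_nat (Suc n - k)) (?H k))"
    by simp
  also have "(\<Sum>k\<le>Suc n. scale (of_nat k) (?H k)) + (\<Sum>k\<le>Suc n. scale (of_nat (Suc n - k)) (?H k))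
    = (\<Sum>k\<le>Suc n. scale (of_nat (Suc n)) (?H k))"
    unfolding sum.distrib[symmetric] scale_add[symmetric] of_nat_add[symmetric]
    by (rule sum.cong) auto
  also have "\<dots> = scale (of_nat (Suc n)) (div_power i (Suc n) (f * g))"
    unfolding div_power_times by (rule klinear_sum[OF klinear_scale_const, symmetric])
  finally show ?thesis .
qed

lemma partial_div_power:
  fixes f :: "('x, 'k :: field) tree_series"
  shows "partial i (div_power i n f) = scale (of_nat (Suc n)) (div_power i (Suc n) f)"
proof -
  have "partial i (div_power i n (monom m)) =
      scale (of_nat (Suc n)) (div_power i (Suc n) (monom m :: ('x, 'k) tree_series))" for n m
  proof (induction m arbitrary: n rule: tree_monomial_induct)
    case one
    show ?case
      by (cases n) (simp_all add: div_power_0 div_power_one partial_one klinear_zero[OF klinear_partial])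
  next
    case (var j)
    show ?case
    proof (cases n)
      case 0
      then show ?thesis by (simp add: div_power_0 div_power_1[unfolded One_nat_def])
    next
      case (Suc k)
      have "partial i (div_power i (Suc 0) (var j)) = 0"
        by (simp add: div_power_1[unfolded One_nat_def] partial_var partial_one klinear_zero[OF klinear_partial])
      with Suc show ?thesis
        by (cases k) (simp_all add: div_power_var klinear_zero[OF klinear_partial])
    qed
  next
    case (times f g)
    show ?case by (rule partial_div_power_times) (rule times)+
  qed
  then have "(\<lambda>f :: ('x, 'k) tree_series. partial i (div_power i n f)) =
      (\<lambda>f. scale (of_nat (Suc n)) (div_power i (Suc n) f))"
    by (intro continuous_linear_eqI klinear_comp[OF klinear_partial klinear_div_power]
        kcontinuous_comp[OF kcontinuous_partial kcontinuous_div_power]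
        klinear_comp[OF klinear_scale_const klinear_div_power]
        kcontinuous_comp[OF kcontinuous_scale_const kcontinuous_div_power])
  from fun_cong[OF this, of f] show ?thesis .
qed

lemma div_power_eq_partial_power:
  fixes f :: "('x, 'k :: field_char_0) tree_series"
  shows "div_power i n f = scale (1 / fact n) ((partial i ^^ n) f)"
proof (induction n)
  case 0
  show ?case by (simp add: div_power_0)
next
  case (Suc n)
  have "of_nat (Suc n) \<noteq> (0 :: 'k)" by (simp del: of_nat_Suc)
  then have "div_power i (Suc n) f = scale (1 / of_nat (Suc n)) (partial i (div_power i n f))"
    by (simp add: partial_div_power scale_scale del: of_nat_Suc)
  also have "\<dots> = scale (1 / fact (Suc n)) ((partial i ^^ Suc n) f)"
    by (simp add: Suc klinear_scale[OF klinear_partial] scale_scale)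
  finally show ?case .
qed

theorem lemma1p9:
  shows
    (* (i) *)
    "(\<forall>t :: 'x :: countable mtree.
       (coadd (monom (Tr t)) :: ('x, 'k :: field_char_0) tensor_series) =
         (\<Sum>I \<in> Pow (leaves t). tensor (monom (contract t I)) (monom (contract t (leaves t - I))))) \<and>
     (\<forall>(t :: 'x mtree) s.
       (coadd_part s (monom (Tr t)) :: ('x, 'k) tree_series) =
         (\<Sum>s' \<in> complements s t. scale (of_nat (compl_mult_in s s' t)) (monom s')) \<and>
       ((\<forall>s' \<in> complements s t. complements s' t = {s}) \<longrightarrow>
        (coadd_part s (monom (Tr t)) :: ('x, 'k) tree_series) =
          (\<Sum>s' \<in> complements s t. scale (of_nat (mult_in s' t)) (monom s')))) \<and>
     \<comment> \<open>(ii)\<close>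
     (\<forall>i :: 'x. (coadd_part (Tr (MLeaf i)) :: ('x, 'k) tree_series \<Rightarrow> _) = partial i) \<and>
     \<comment> \<open>(iii)\<close>
     (\<forall>s t :: 'x mtree.
       (coadd_part (Tr s) \<circ> coadd_part (Tr t) :: ('x, 'k) tree_series \<Rightarrow> _) =
         coadd_part (Tr t) \<circ> coadd_part (Tr s)) \<and>
     \<comment> \<open>(iv)\<close>
     (\<forall>(s :: 'x mtree) s1 s2 (f :: ('x, 'k) tree_series) g. s = MNode s1 s2 \<longrightarrow>
       coadd_part (Tr s) (f * g) =
         coadd_part (Tr s) f * g + f * coadd_part (Tr s) g
         + coadd_part (Tr s1) f * coadd_part (Tr s2) g) \<and>
     (\<forall>(s :: 'x mtree) s1 s2 t t1 t2. s = MNode s1 s2 \<longrightarrow> t = MNode t1 t2 \<longrightarrow>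
       mult_in (Tr s) t =
         mult_in (Tr s) t1 + mult_in (Tr s) t2 + mult_in (Tr s1) t1 * mult_in (Tr s2) t2) \<and>
     \<comment> \<open>(v)\<close>
     (\<forall>(i :: 'x) n (f :: ('x, 'k) tree_series). n \<ge> 1 \<longrightarrow>
       (\<Sum>s \<in> one_var_trees i n. coadd_part (Tr s) f) = scale (1 / fact n) ((partial i ^^ n) f))"
proof (intro conjI allI impI)
  fix t :: "'x mtree"
  show "(coadd (monom (Tr t)) :: ('x, 'k) tensor_series) =
    (\<Sum>I \<in> Pow (leaves t). tensor (monom (contract t I)) (monom (contract t (leaves t - I))))"
    by (simp add: coadd_monom_Tr tensor_monom)
next
  fix t :: "'x mtree" and s
  show *: "(coadd_part s (monom (Tr t)) :: ('x, 'k) tree_series) =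
    (\<Sum>s' \<in> complements s t. scale (of_nat (compl_mult_in s s' t)) (monom s'))"
    by (rule coadd_part_monom_Tr)
  assume "\<forall>s' \<in> complements s t. complements s' t = {s}"
  then show "(coadd_part s (monom (Tr t)) :: ('x, 'k) tree_series) =
    (\<Sum>s' \<in> complements s t. scale (of_nat (mult_in s' t)) (monom s'))"
    unfolding * by (simp add: compl_mult_in_eq_mult_in)
next
  fix i :: 'x
  show "(coadd_part (Tr (MLeaf i)) :: ('x, 'k) tree_series \<Rightarrow> _) = partial i"
    by (rule coadd_part_MLeaf)
next
  fix s t :: "'x mtree"
  show "(coadd_part (Tr s) \<circ> coadd_part (Tr t) :: ('x, 'k) tree_series \<Rightarrow> _) =
    coadd_part (Tr t) \<circ> coadd_part (Tr s)"
    by (simp add: fun_eq_iff coadd_part_commute[of "Tr s"])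
next
  fix s s1 s2 :: "'x mtree" and f g :: "('x, 'k) tree_series"
  assume "s = MNode s1 s2"
  then show "coadd_part (Tr s) (f * g) = coadd_part (Tr s) f * g + f * coadd_part (Tr s) g
      + coadd_part (Tr s1) f * coadd_part (Tr s2) g"
    by (simp add: coadd_part_MNode_times)
next
  fix s s1 s2 t t1 t2 :: "'x mtree"
  assume "s = MNode s1 s2" "t = MNode t1 t2"
  then show "mult_in (Tr s) t =
      mult_in (Tr s) t1 + mult_in (Tr s) t2 + mult_in (Tr s1) t1 * mult_in (Tr s2) t2"
    by (simp add: mult_in_MNode factorizations_MNode mult_in_one)
next
  fix i :: 'x and n :: nat and f :: "('x, 'k) tree_series"
  assume "n \<ge> 1"
  then have "(\<Sum>s \<in> one_var_trees i n. coadd_part (Tr s) f) = div_power i n f"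
    by (simp add: div_power_def one_var_utrees_pos sum.reindex inj_on_def)
  then show "(\<Sum>s \<in> one_var_trees i n. coadd_part (Tr s) f) = scale (1 / fact n) ((partial i ^^ n) f)"
    by (simp only: div_power_eq_partial_power)
qed

end
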